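(* For any nonnegative integer $n$, the map $\varphi_n$ is a poset isomorphism from $K(S_{n+1})$ to $K(B_n)$ under the left weak order; here $K(S_{n+1})$ and $K(B_n)$ are regarded as induced subposets of $(S_{n+1},\le_L)$ and $(B_n,\le_L)$ respectively.
   Context: Notation: $[m,n]=\{m,\dots,n\}$, $[n]=[1,n]$, $\bar a=-a$. $S_n$ is the symmetric group on $[n]$. $B_n$ is the group of signed permutations: bijections $w$ of $\{\pm1,\dots,\pm n\}$ with $w(-i)=-w(i)$, written $w=w_1\cdots w_n$, $w_i=w(i)$; $S_n\subseteq B_n$ consists of those with all $w_i>0$. $B_0=\{\varepsilon\}$ with $\varepsilon$ the empty signed permutation. For a word $a$ of distinct integers, $\mathrm{st}(a)\in S_m$ is the permutation with the same relative order as $a$. For a word $a=a_1\cdots a_m$ of nonzero integers with distinct absolute values, $\mathrm{sts}(a)\in B_m$ is the signed permutation whose $i$-th entry has the sign of $a_i$ and whose absolute values have the same relative order as $|a_1|,\dots,|a_m|$. $w$ contains the pattern $u\in B_m$ if $\mathrm{sts}(w_{i_1}\cdots w_{i_m})=u$ for some $i_1<\cdots<i_m$; otherwise it avoids $u$. $K(B_n)$ is the set of separable $w\in B_n$, i.e. those avoiding $\bar21$, $2\bar1$, $3142$, $2413$, $\bar3\,\bar1\,\bar4\,\bar2$, $\bar2\,\bar4\,\bar1\,\bar3$. $K(S_n)=K(B_n)\cap S_n$ is the set of permutations avoiding $3142$ and $2413$. For $u\in B_p$, $v\in B_q$: $u\oplus v\in B_{p+q}$ has $(u\oplus v)_i=u_i$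 for $i\le p$ and $v_{i-p}+(\mathrm{sgn}\,v_{i-p})p$ for $i>p$; $\varepsilon$ is the identity for $\oplus$. $w_0^{S_m}=m(m-1)\cdots1$ and $w_0^{B_m}=\bar1\,\bar2\cdots\bar m$, products being compositions: for $v\in S_m$, $w_0^{B_m}w_0^{S_m}v$ has entries $-(m+1-v_i)$. For $w\in S_n$, $p\in[n-1]$ is a global ascent ($p\in\mathrm{GAsc}(w)$), resp. global descent ($p\in\mathrm{GDes}(w)$), if $w_i<w_j$, resp. $w_i>w_j$, for all $i\in[p]$, $j\in[p+1,n]$. Every separable permutation of length at least $2$ has a global ascent or a global descent. The map $\varphi_n:K(S_{n+1})\to K(B_n)$ is defined recursively by $\varphi_0(1)=\varepsilon$ and, for $n\ge1$ and $w\in K(S_{n+1})$, $$\varphi_n(w)=\begin{cases}\varphi_{p-1}(w_1\cdots w_p)\oplus\mathrm{st}(w_{p+1}\cdots w_{n+1}),&p\in\mathrm{GAsc}(w),\\ \varphi_{p-1}(\mathrm{st}(w_1\cdots w_p))\oplus w_0^{B_{n+1-p}}w_0^{S_{n+1-p}}(w_{p+1}\cdots w_{n+1}),&p\in\mathrm{GDes}(w),\end{cases}$$ the value being independent of the choice of $p$. Left weak order: in $W=S_n$ or $W=B_n$, $u\le_L w$ iff $\ell(w)=\ell(u)+\ell(wu^{-1})$, where $\ell$ is Coxeter length with respect to the standard generators (adjacent transpositions $s_i$, $1\le i\le n-1$, and for $B_n$ also $s_0=\bar1\,2\cdots n$) and $(uv)(i)=u(v(i))$. Explicitly, for $w\in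 B_n$, $\ell(w)=\#\{i:w_i<0\}+\#\{i<j:w_i>w_j\}+\#\{i<j:w_i+w_j<0\}$ (indices in $[n]$), and for $w\in S_n$ it is the number of inversions. *)

theory Defs
  imports Main "HOL-Combinatorics.Permutations"
begin

text \<open>
  A signed permutation is a function on all integers that is the identity outside
  \<open>{\<plusminus>1, \<dots>, \<plusminus>n}\<close>. The rank \<open>n\<close> cannot be recovered from the function (appending
  fixed points does not change it), so it is passed explicitly where it matters.
  In particular both the permutation \<open>1\<close> of rank 1 and the empty signed permutation
  of rank 0 are represented by \<^term>\<open>id\<close>.
\<close>

definition signed_perms :: "nat \<Rightarrow> (int \<Rightarrow> int) set" where
  "signed_perms n =
     {w. w permutes ({- int n..int n} - {0}) \<and> (\<forall>i. w (- i) = - w i)}"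

definition perms :: "nat \<Rightarrow> (int \<Rightarrow> int) set" where
  "perms n = {w \<in> signed_perms n. \<forall>i\<in>{1..int n}. w i > 0}"

text \<open>The word \<open>w\<^sub>a \<cdots> w\<^sub>b\<close>, and conversely the signed permutation with a given word.\<close>

definition word :: "(int \<Rightarrow> int) \<Rightarrow> nat \<Rightarrow> nat \<Rightarrow> int list" where
  "word w a b = map w [int a..int b]"

definition of_word :: "int list \<Rightarrow> int \<Rightarrow> int" where
  "of_word a = (\<lambda>i. if 1 \<le> \<bar>i\<bar> \<and> \<bar>i\<bar> \<le> int (length a) then sgn i * a ! nat (\<bar>i\<bar> - 1) else i)"

text \<open>Standardizations, for words of distinct integers and for words of nonzero integers
  with distinct absolute values, respectively.\<close>

definition st :: "int list \<Rightarrow> int list" where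
  "st a = map (\<lambda>x. int (card {y \<in> set a. y \<le> x})) a"

definition sts :: "int list \<Rightarrow> int list" where
  "sts a = map (\<lambda>x. sgn x * int (card {y \<in> set a. \<bar>y\<bar> \<le> \<bar>x\<bar>})) a"

definition contains_pattern :: "nat \<Rightarrow> (int \<Rightarrow> int) \<Rightarrow> int list \<Rightarrow> bool" where
  "contains_pattern n w u \<longleftrightarrow>
     (\<exists>js. sorted_wrt (<) js \<and> set js \<subseteq> {1..int n} \<and> sts (map w js) = u)"

definition separable_B :: "nat \<Rightarrow> (int \<Rightarrow> int) set" where
  "separable_B n =
     {w \<in> signed_perms n.
        \<forall>u \<in> {[-2, 1], [2, -1], [3, 1, 4, 2], [2, 4, 1, 3], [-3, -1, -4, -2], [-2, -4, -1, -3]}.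
          \<not> contains_pattern n w u}"

definition separable_S :: "nat \<Rightarrow> (int \<Rightarrow> int) set" where
  "separable_S n = separable_B n \<inter> perms n"

text \<open>The argument \<open>p\<close> is the rank of the left summand \<open>u\<close>.\<close>

definition oplus :: "nat \<Rightarrow> (int \<Rightarrow> int) \<Rightarrow> (int \<Rightarrow> int) \<Rightarrow> int \<Rightarrow> int" where
  "oplus p u v = (\<lambda>i. if \<bar>i\<bar> \<le> int p then u i
     else v (i - sgn i * int p) + sgn (v (i - sgn i * int p)) * int p)"

definition longest_S :: "nat \<Rightarrow> int \<Rightarrow> int" where
  "longest_S m = of_word (rev [1..int m])"

definition longest_B :: "nat \<Rightarrow> int \<Rightarrow> int" where
  "longest_B m = of_word (map uminus [1..int m])"

definition global_ascents :: "nat \<Rightarrow> (int \<Rightarrow> int) \<Rightarrow> nat set" where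
  "global_ascents n w =
     {p \<in> {1..<n}. \<forall>i\<in>{1..int p}. \<forall>j\<in>{int p + 1..int n}. w i < w j}"

definition global_descents :: "nat \<Rightarrow> (int \<Rightarrow> int) \<Rightarrow> nat set" where
  "global_descents n w =
     {p \<in> {1..<n}. \<forall>i\<in>{1..int p}. \<forall>j\<in>{int p + 1..int n}. w i > w j}"

text \<open>The recursion for \<open>\<phi>\<close> allows any global ascent or descent \<open>p\<close>. It is therefore given
  as a relation closed under all choices of \<open>p\<close>; \<open>\<phi> n w\<close> is the unique value related to \<open>w\<close>.\<close>

inductive phi_graph :: "nat \<Rightarrow> (int \<Rightarrow> int) \<Rightarrow> (int \<Rightarrow> int) \<Rightarrow> bool" where
  base: "phi_graph 0 id id"
| asc: "n \<ge> 1 \<Longrightarrow> w \<in> separable_S (n + 1) \<Longrightarrow> p \<in> global_ascents (n + 1) w \<Longrightarrow>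
    phi_graph (p - 1) (of_word (word w 1 p)) x \<Longrightarrow>
    phi_graph n w (oplus (p - 1) x (of_word (st (word w (p + 1) (n + 1)))))"
| desc: "n \<ge> 1 \<Longrightarrow> w \<in> separable_S (n + 1) \<Longrightarrow> p \<in> global_descents (n + 1) w \<Longrightarrow>
    phi_graph (p - 1) (of_word (st (word w 1 p))) x \<Longrightarrow>
    phi_graph n w (oplus (p - 1) x
      (longest_B (n + 1 - p) \<circ> longest_S (n + 1 - p) \<circ> of_word (word w (p + 1) (n + 1))))"

definition phi :: "nat \<Rightarrow> (int \<Rightarrow> int) \<Rightarrow> int \<Rightarrow> int" where
  "phi n w = (THE v. phi_graph n w v)"

definition simple_reflection :: "nat \<Rightarrow> int \<Rightarrow> int" where
  "simple_reflection i = (if i = 0 then transpose 1 (- 1)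
     else transpose (int i) (int i + 1) \<circ> transpose (- int i) (- int i - 1))"

definition generators_S :: "nat \<Rightarrow> (int \<Rightarrow> int) set" where
  "generators_S n = simple_reflection ` {1..<n}"

definition generators_B :: "nat \<Rightarrow> (int \<Rightarrow> int) set" where
  "generators_B n = simple_reflection ` {0..<n}"

definition coxeter_length :: "(int \<Rightarrow> int) set \<Rightarrow> (int \<Rightarrow> int) \<Rightarrow> nat" where
  "coxeter_length G w = (LEAST k. \<exists>gs. length gs = k \<and> set gs \<subseteq> G \<and> foldr (\<circ>) gs id = w)"

text \<open>Only meaningful for \<open>u\<close> and \<open>w\<close> in the group generated by \<open>G\<close>.\<close>

definition left_weak_le :: "(int \<Rightarrow> int) set \<Rightarrow> (int \<Rightarrow> int) \<Rightarrow> (int \<Rightarrow> int) \<Rightarrow> bool" where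
  "left_weak_le G u w \<longleftrightarrow>
     coxeter_length G w = coxeter_length G u + coxeter_length G (w \<circ> inv u)"

end

theory Submission
  imports Defs
begin

text \<open>
  In both groups \<open>u \<le>\<^sub>L w\<close> means that every inversion of \<open>u\<close> is an inversion of \<open>w\<close>. Let
  \<open>v = \<phi> w\<close>. The word \<open>0 v\<^sub>1 \<dots> v\<^sub>n\<close> has the same relative order as \<open>w\<^sub>1 \<dots> w\<^sub>n\<^sub>+\<^sub>1\<close>: an outer block of
  the recursion consists of values above (below) everything inside it and receives large
  positive (negative) entries. Moreover \<open>v\<^sub>i + v\<^sub>j < 0\<close> iff \<open>v\<^sub>j < 0\<close> for \<open>i < j\<close>, which is what
  avoiding the two signed patterns of length two means. So the inversion set of \<open>w\<close> determines that
  of \<open>v\<close> monotonically and vice versa, and the inverse map is \<open>v \<mapsto> st (0 v\<^sub>1 \<dots> v\<^sub>n)\<close>.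
\<close>

section \<open>Signed permutations\<close>

text \<open>The letter 0 comes from the signs: an entry of v is negative exactly when the matching
  letter of w is smaller than w_1. So w_1 plays the part of 0, which is why rank n + 1 on one side
  meets rank n on the other. All inversions of v of the form e_j or e_i + e_j with i < j then record
  the single comparison of w_{j+1} with w_1.

  The recursion leaves the splitting position open, so \<open>phi\<close> is a function only if all
  choices agree. The choices are never compared with each other: \<open>phi_rel\<close> describes
  the value without recursion, every recursive step preserves it, and it determines v through its
  inversions.

  \<open>coxeter_length\<close> is a minimal word length, so its relation to inversions has to be
  proved. The decisive count is that w u^{-1} has as many inversions as the symmetric difference of
  the inversion sets of u and w has elements; containment is then the case of additive
  lengths.\<close>

lemma signed_permsI:
  assumes odd: "\<And>i. f (- i) = - f i"
    and out: "\<And>i. i > int n \<Longrightarrow> f i = i"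
    and rng: "\<And>i. 1 \<le> i \<Longrightarrow> i \<le> int n \<Longrightarrow> 1 \<le> \<bar>f i\<bar> \<and> \<bar>f i\<bar> \<le> int n"
    and inj: "\<And>i j. 1 \<le> i \<Longrightarrow> i < j \<Longrightarrow> j \<le> int n \<Longrightarrow> \<bar>f i\<bar> \<noteq> \<bar>f j\<bar>"
  shows "f \<in> signed_perms n"
proof -
  let ?X = "{- int n..int n} - {0}"
  have f0: "f 0 = 0" using odd[of 0] by simp
  have abs: "\<bar>f i\<bar> = \<bar>f \<bar>i\<bar>\<bar>" for i using odd[of i] by (auto simp: abs_if)
  have sub: "f ` ?X \<subseteq> ?X"
  proof
    fix y assume "y \<in> f ` ?X"
    then obtain i where i: "i \<in> ?X" "y = f i" by blast
    have "1 \<le> \<bar>f \<bar>i\<bar>\<bar> \<and> \<bar>f \<bar>i\<bar>\<bar> \<le> int n" using i by (intro rng) auto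
    with i abs[of i] show "y \<in> ?X" by auto
  qed
  have inj_f: "inj_on f ?X"
  proof (rule inj_onI)
    fix i j assume ij: "i \<in> ?X" "j \<in> ?X" "f i = f j"
    have "\<bar>f \<bar>i\<bar>\<bar> = \<bar>f \<bar>j\<bar>\<bar>" using abs ij(3) by metis
    moreover have "1 \<le> \<bar>i\<bar>" "\<bar>i\<bar> \<le> int n" "1 \<le> \<bar>j\<bar>" "\<bar>j\<bar> \<le> int n" using ij by auto
    ultimately have "\<bar>i\<bar> = \<bar>j\<bar>"
      using inj[of "\<bar>i\<bar>" "\<bar>j\<bar>"] inj[of "\<bar>j\<bar>" "\<bar>i\<bar>"] by linarith
    moreover have "f i \<noteq> 0" using sub ij(1) by blast
    ultimately show "i = j" using odd[of i] ij(3) by (auto simp: abs_if split: if_splits)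
  qed
  have "bij_betw f ?X ?X"
    using inj_f sub by (simp add: bij_betw_def endo_inj_surj)
  moreover have "f i = i" if "i \<notin> ?X" for i
    using that f0 out[of i] out[of "- i"] odd[of i] by (cases "i = 0"; cases "i > int n") auto
  ultimately have "f permutes ?X" by (rule bij_imp_permutes)
  then show ?thesis using odd by (simp add: signed_perms_def)
qed

lemma permsI:
  assumes "\<And>i. f (- i) = - f i" "\<And>i. i > int n \<Longrightarrow> f i = i"
    and "\<And>i. 1 \<le> i \<Longrightarrow> i \<le> int n \<Longrightarrow> 1 \<le> f i \<and> f i \<le> int n"
    and "\<And>i j. 1 \<le> i \<Longrightarrow> i < j \<Longrightarrow> j \<le> int n \<Longrightarrow> f i \<noteq> f j"
  shows "f \<in> perms n"
proof -
  have "f \<in> signed_perms n"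
  proof (rule signed_permsI)
    fix i j assume "1 \<le> i" "i < j" "j \<le> int n"
    with assms(3)[of i] assms(3)[of j] assms(4)[of i j] show "\<bar>f i\<bar> \<noteq> \<bar>f j\<bar>" by auto
  qed (use assms in force)+
  then show ?thesis using assms(3) by (force simp: perms_def)
qed

lemma signed_perms_minus: "w \<in> signed_perms n \<Longrightarrow> w (- i) = - w i"
  by (simp add: signed_perms_def)

lemma signed_perms_zero: "w \<in> signed_perms n \<Longrightarrow> w 0 = 0"
  using signed_perms_minus[of w n 0] by simp

lemma signed_perms_bij: "w \<in> signed_perms n \<Longrightarrow> bij w"
  by (auto simp: signed_perms_def permutes_bij)

lemma signed_perms_eq_iff: "w \<in> signed_perms n \<Longrightarrow> w i = w j \<longleftrightarrow> i = j"
  by (rule inj_eq[OF bij_is_inj[OF signed_perms_bij]])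

lemma signed_perms_eq_zero_iff: "w \<in> signed_perms n \<Longrightarrow> w i = 0 \<longleftrightarrow> i = 0"
  using signed_perms_eq_iff[of w n i 0] signed_perms_zero[of w n] by simp

lemma signed_perms_outside:
  assumes "w \<in> signed_perms n" "\<bar>i\<bar> > int n" shows "w i = i"
proof -
  have "w permutes {- int n..int n} - {0}" using assms(1) by (simp add: signed_perms_def)
  moreover have "i \<notin> {- int n..int n} - {0}" using assms(2) by auto
  ultimately show ?thesis by (rule permutes_not_in)
qed

lemma signed_perms_abs_le_iff:
  assumes "w \<in> signed_perms n" shows "\<bar>w i\<bar> \<le> int n \<longleftrightarrow> \<bar>i\<bar> \<le> int n"
proof -
  have "w permutes {- int n..int n} - {0}" using assms by (simp add: signed_perms_def)
  from permutes_in_image[OF this, of i] show ?thesis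
    using signed_perms_eq_zero_iff[OF assms, of i] by (cases "i = 0") auto
qed

lemma signed_perms_abs_eq:
  assumes "w \<in> signed_perms n" "\<bar>w i\<bar> = \<bar>w j\<bar>" shows "\<bar>i\<bar> = \<bar>j\<bar>"
proof -
  have "w i = w j \<or> w i = w (- j)"
    using assms by (auto simp: signed_perms_minus[OF assms(1)] abs_if split: if_splits)
  then show ?thesis using signed_perms_eq_iff[OF assms(1)] by auto
qed

lemma signed_perms_comp:
  "u \<in> signed_perms n \<Longrightarrow> w \<in> signed_perms n \<Longrightarrow> u \<circ> w \<in> signed_perms n"
  unfolding signed_perms_def by (simp add: permutes_compose)

lemma id_signed_perms: "id \<in> signed_perms n"
  by (simp add: signed_perms_def permutes_id del: id_apply) simp

lemma signed_perms_inv: "w \<in> signed_perms n \<Longrightarrow> inv w \<in> signed_perms n"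
proof -
  assume w: "w \<in> signed_perms n"
  have "inv w (- i) = - inv w i" for i
  proof -
    have "w (- inv w i) = - i"
      using signed_perms_bij[OF w] by (simp add: signed_perms_minus[OF w] bij_is_surj surj_f_inv_f)
    then show ?thesis using signed_perms_bij[OF w] by (metis bij_inv_eq_iff)
  qed
  with w show ?thesis by (auto simp: signed_perms_def permutes_inv)
qed

lemma perms_signed: "w \<in> perms n \<Longrightarrow> w \<in> signed_perms n"
  by (simp add: perms_def)

lemma perms_pos_iff: "w \<in> perms n \<Longrightarrow> w i > 0 \<longleftrightarrow> i > 0"
proof -
  assume w: "w \<in> perms n"
  have *: "w i > 0" if "i > 0" for i
  proof (cases "i \<le> int n")
    case True with that w show ?thesis by (auto simp: perms_def)
  next
    case False with that w show ?thesis using signed_perms_outside[OF perms_signed[OF w], of i] by simp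
  qed
  show ?thesis
    using *[of i] *[of "- i"] signed_perms_minus[OF perms_signed[OF w], of i]
      signed_perms_zero[OF perms_signed[OF w]] by (cases i "0::int" rule: linorder_cases) auto
qed

lemma perms_comp:
  assumes "u \<in> perms n" "w \<in> perms n" shows "u \<circ> w \<in> perms n"
proof -
  have "u (w i) > 0" if "i > 0" for i
    using that assms by (simp add: perms_pos_iff)
  then show ?thesis
    using signed_perms_comp[OF perms_signed[OF assms(1)] perms_signed[OF assms(2)]]
    by (simp add: perms_def)
qed

lemma perms_inv: "w \<in> perms n \<Longrightarrow> inv w \<in> perms n"
proof -
  assume w: "w \<in> perms n"
  have "inv w i > 0" if "i > 0" for i
    using perms_pos_iff[OF w, of "inv w i"] that signed_perms_bij[OF perms_signed[OF w]]
    by (simp add: bij_is_surj surj_f_inv_f)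
  with signed_perms_inv[OF perms_signed[OF w]] show ?thesis by (auto simp: perms_def)
qed

lemma perms_image: "w \<in> perms n \<Longrightarrow> w ` {1..int n} = {1..int n}"
proof (rule endo_inj_surj)
  assume w: "w \<in> perms n"
  show "w ` {1..int n} \<subseteq> {1..int n}"
  proof
    fix y assume "y \<in> w ` {1..int n}"
    then obtain i where i: "1 \<le> i" "i \<le> int n" "y = w i" by auto
    then show "y \<in> {1..int n}"
      using signed_perms_abs_le_iff[OF perms_signed[OF w], of i] perms_pos_iff[OF w, of i] by auto
  qed
  show "inj_on w {1..int n}"
    by (meson inj_onI signed_perms_eq_iff[OF perms_signed[OF w]])
qed simp

section \<open>Inversions and the left weak order\<close>

text \<open>A pair \<open>(i, j)\<close> with \<open>0 < i\<close>, \<open>i = - j\<close> or \<open>- j < i < 0\<close> stands for the positive root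
  \<open>e\<^sub>j - e\<^sub>i\<close>, \<open>e\<^sub>j\<close> or \<open>e\<^sub>j + e\<^sub>-\<^sub>i\<close>; the three kinds of inversions of \<open>w\<close> then all read
  \<open>w i > w j\<close>.\<close>

definition roots :: "nat \<Rightarrow> (int \<times> int) set" where
  "roots n = {(i, j). 1 \<le> j \<and> j \<le> int n \<and> - j \<le> i \<and> i < j \<and> i \<noteq> 0}"

definition inversions :: "nat \<Rightarrow> (int \<Rightarrow> int) \<Rightarrow> (int \<times> int) set" where
  "inversions n w = {(i, j) \<in> roots n. w j < w i}"

text \<open>Reading (i, j) as e_j - e_i with e_{-i} = - e_i, the pair (- j, - i) encodes the same
  root and the other two pairs its negative. An orbit is thus a root up to sign.\<close>

definition root_orbit :: "int \<times> int \<Rightarrow> (int \<times> int) set" where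
  "root_orbit = (\<lambda>(i, j). {(i, j), (j, i), (- i, - j), (- j, - i)})"

lemma finite_roots: "finite (roots n)"
  by (rule finite_subset[of _ "{- int n..int n} \<times> {- int n..int n}"]) (auto simp: roots_def)

lemma finite_inversions: "finite (inversions n w)"
  unfolding inversions_def by (rule finite_subset[OF _ finite_roots[of n]]) blast

lemma inversions_id: "inversions n id = {}"
  by (auto simp: inversions_def roots_def)

lemma inj_on_root_orbit: "inj_on root_orbit (roots n)"
proof (rule inj_onI, clarify)
  fix i j k l assume *: "(i, j) \<in> roots n" "(k, l) \<in> roots n" "root_orbit (i, j) = root_orbit (k, l)"
  have "(i, j) \<in> root_orbit (i, j)" by (simp add: root_orbit_def)
  with *(3) have "(i, j) \<in> root_orbit (k, l)" by simp
  with *(1,2) show "i = k \<and> j = l" by (auto simp: root_orbit_def roots_def)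
qed

text \<open>All ordered pairs are allowed here, not only those in \<open>roots\<close>: relabelling
  by a signed permutation does not preserve the chosen positive roots, but it does preserve this
  symmetric form.\<close>

definition discord :: "nat \<Rightarrow> (int \<Rightarrow> int) \<Rightarrow> (int \<Rightarrow> int) \<Rightarrow> (int \<times> int) set" where
  "discord n u w = {(i, j). 0 < \<bar>i\<bar> \<and> \<bar>i\<bar> \<le> int n \<and> 0 < \<bar>j\<bar> \<and> \<bar>j\<bar> \<le> int n \<and> i \<noteq> j \<and>
     (u i < u j) \<noteq> (w i < w j)}"

text \<open>\<open>discord\<close> is a union of orbits, each of which contains exactly one pair
  from \<open>roots\<close>. Such a pair is discordant iff it is an inversion of exactly one of u
  and w.\<close>

lemma card_orbits_discord:
  assumes u: "u \<in> signed_perms n" and w: "w \<in> signed_perms n"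
  shows "card (root_orbit ` discord n u w) = card (sym_diff (inversions n u) (inversions n w))"
proof -
  have eq: "sym_diff (inversions n u) (inversions n w) = roots n \<inter> discord n u w"
  proof (rule set_eqI, clarify)
    fix i j
    have "u i = u j \<longleftrightarrow> i = j" "w i = w j \<longleftrightarrow> i = j"
      using signed_perms_eq_iff u w by metis+
    then show "(i, j) \<in> sym_diff (inversions n u) (inversions n w) \<longleftrightarrow> (i, j) \<in> roots n \<inter> discord n u w"
      by (auto simp: inversions_def discord_def roots_def)
  qed
  have "root_orbit ` discord n u w = root_orbit ` (roots n \<inter> discord n u w)"
  proof (intro equalityI image_subsetI)
    fix r assume r: "r \<in> discord n u w"
    obtain i j where ij: "r = (i, j)" by force
    have sub: "root_orbit r \<subseteq> discord n u w"
      using r signed_perms_eq_iff[OF u, of i j] signed_perms_eq_iff[OF w, of i j]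
      by (auto simp: ij root_orbit_def discord_def signed_perms_minus[OF u] signed_perms_minus[OF w])
    have "(i, j) \<in> roots n \<or> (j, i) \<in> roots n \<or> (- i, - j) \<in> roots n \<or> (- j, - i) \<in> roots n"
      using r unfolding ij roots_def discord_def by simp (smt (verit))
    then have "\<exists>r'\<in>root_orbit r. r' \<in> roots n" by (simp add: ij root_orbit_def)
    then obtain r' where r': "r' \<in> roots n" "r' \<in> root_orbit r" by blast
    moreover have "root_orbit r' = root_orbit r"
      using r'(2) by (auto simp: ij root_orbit_def)
    ultimately show "root_orbit r \<in> root_orbit ` (roots n \<inter> discord n u w)"
      using sub by (metis IntI image_eqI subsetD)
  qed blast
  then have "card (root_orbit ` discord n u w) = card (roots n \<inter> discord n u w)"
    by (metis card_image inf_le1 inj_on_subset inj_on_root_orbit)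
  with eq show ?thesis by simp
qed

text \<open>Applying u to both indices turns the discord of u and w into that of the identity and w
  u^{-1}, orbit by orbit. The identity has no inversions, so the count on that side is just that of
  w u^{-1}.\<close>

lemma card_inversions_comp_inv:
  assumes u: "u \<in> signed_perms n" and w: "w \<in> signed_perms n"
  shows "card (inversions n (w \<circ> inv u)) = card (sym_diff (inversions n u) (inversions n w))"
proof -
  let ?U = "map_prod u u"
  have x: "w \<circ> inv u \<in> signed_perms n" using u w by (simp add: signed_perms_comp signed_perms_inv)
  have iu: "inv u (u i) = i" for i using signed_perms_bij[OF u] by (simp add: bij_is_inj)
  have inj_U: "inj ?U" using signed_perms_bij[OF u] by (simp add: bij_is_inj prod.inj_map)
  have discord_U: "discord n id (w \<circ> inv u) = ?U ` discord n u w"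
  proof (intro equalityI subsetI)
    fix r assume r: "r \<in> discord n id (w \<circ> inv u)"
    obtain i j where "r = (u i, u j)"
      using signed_perms_bij[OF u] by (metis bij_pointE surj_pair)
    with r show "r \<in> ?U ` discord n u w"
      using signed_perms_eq_zero_iff[OF u] signed_perms_abs_le_iff[OF u]
      by (intro image_eqI[of _ _ "(i, j)"]) (auto simp: discord_def iu)
  next
    fix r assume "r \<in> ?U ` discord n u w"
    then show "r \<in> discord n id (w \<circ> inv u)"
      using signed_perms_eq_zero_iff[OF u] signed_perms_abs_le_iff[OF u] signed_perms_eq_iff[OF u]
      by (auto simp: discord_def iu)
  qed
  have orb: "root_orbit (?U r) = ?U ` root_orbit r" for r
    by (auto simp: root_orbit_def signed_perms_minus[OF u] split: prod.splits)
  have "card (inversions n (w \<circ> inv u)) = card (root_orbit ` discord n id (w \<circ> inv u))"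
    by (simp add: card_orbits_discord[OF id_signed_perms x] inversions_id)
  also have "root_orbit ` discord n id (w \<circ> inv u) = image ?U ` root_orbit ` discord n u w"
    by (simp add: discord_U image_image orb)
  also have "card \<dots> = card (root_orbit ` discord n u w)"
    by (rule card_image) (meson inj_U inj_image_eq_iff inj_onI)
  finally show ?thesis unfolding card_orbits_discord[OF u w] .
qed

text \<open>The chain starts at w 0 = 0, which accounts for the generator s_0. It takes n strict
  integer steps and ends at most at n, so every step is exactly 1.\<close>

lemma increasing_signed_perm_eq_id:
  assumes w: "w \<in> signed_perms n" and inc: "\<And>i. i < n \<Longrightarrow> w (int i) < w (int i + 1)"
  shows "w = id"
proof -
  have ge: "w (int i) \<ge> int i" if "i \<le> n" for i
    using that
  proof (induction i)
    case 0 then show ?case by (simp add: signed_perms_zero[OF w])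
  next
    case (Suc i) then show ?case using inc[of i] by (simp add: add.commute)
  qed
  have le: "w (int i) \<le> int i" if "i \<le> n" for i
    using that
  proof (induction i rule: inc_induct)
    case base then show ?case using signed_perms_abs_le_iff[OF w, of "int n"] by simp
  next
    case (step i) then show ?case using inc[of i] by (simp add: add.commute)
  qed
  have eq: "w (int i) = int i" for i
    using ge[of i] le[of i] signed_perms_outside[OF w, of "int i"] by force
  show ?thesis
  proof
    fix i show "w i = id i"
      using eq[of "nat i"] eq[of "nat (- i)"] signed_perms_minus[OF w, of i] by (cases "i \<ge> 0") auto
  qed
qed

section \<open>Simple reflections and Coxeter length\<close>

lemma simple_reflection_apply:
  "simple_reflection 0 x = (if x = 1 then -1 else if x = -1 then 1 else x)"
  "i \<ge> 1 \<Longrightarrow> simple_reflection i x =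
     (if x = int i then int i + 1 else if x = int i + 1 then int i
      else if x = - int i then - int i - 1 else if x = - int i - 1 then - int i else x)"
  by (simp_all add: simple_reflection_def transpose_def)

lemma simple_reflection_signed:
  assumes "i < n" shows "simple_reflection i \<in> signed_perms n"
proof -
  have "simple_reflection i permutes {- int n..int n} - {0}"
    using assms by (cases "i = 0")
      (auto simp: simple_reflection_def intro!: permutes_swap_id permutes_compose)
  moreover have "simple_reflection i (- x) = - simple_reflection i x" for x
    by (cases "i = 0") (simp_all add: simple_reflection_apply)
  ultimately show ?thesis by (simp add: signed_perms_def)
qed

lemma simple_reflection_perms:
  assumes "1 \<le> i" "i < n" shows "simple_reflection i \<in> perms n"
proof -
  have "simple_reflection i x > 0" if "x \<ge> 1" for x
    using that assms by (simp add: simple_reflection_apply)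
  with simple_reflection_signed[OF assms(2)] show ?thesis by (simp add: perms_def)
qed

lemma simple_reflection_involution: "simple_reflection i \<circ> simple_reflection i = id"
  by (rule ext; cases "i = 0") (simp_all add: simple_reflection_apply)

lemma inv_simple_reflection: "inv (simple_reflection i) = simple_reflection i"
  using simple_reflection_involution by (intro inv_unique_comp)

definition simple_root :: "nat \<Rightarrow> int \<times> int" where
  "simple_root i = (if i = 0 then (-1, 1) else (int i, int i + 1))"

lemma inversions_simple_reflection:
  assumes "i < n" shows "inversions n (simple_reflection i) = {simple_root i}"
proof (cases "i = 0")
  case True
  have "(j, k) \<in> inversions n (simple_reflection 0) \<longleftrightarrow> (j, k) = (- 1, 1)" for j k
    using assms by (simp add: inversions_def roots_def simple_reflection_apply)
  with True show ?thesis by (auto simp: simple_root_def)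
next
  case False
  have "(j, k) \<in> inversions n (simple_reflection i) \<longleftrightarrow> (j, k) = (int i, int i + 1)" for j k
  proof
    assume *: "(j, k) \<in> inversions n (simple_reflection i)"
    \<comment> \<open>Each point moves by at most 1, so only neighbouring indices can be put out of
      order.\<close>
    have near: "\<bar>simple_reflection i x - x\<bar> \<le> 1" for x
      using False by (simp add: simple_reflection_apply)
    have "j < k" "simple_reflection i k < simple_reflection i j"
      using * by (auto simp: inversions_def roots_def)
    then have "k = j + 1" using near[of j] near[of k] by linarith
    with * False show "(j, k) = (int i, int i + 1)"
      by (simp add: inversions_def roots_def simple_reflection_apply split: if_splits)
  qed (use assms False in \<open>simp add: inversions_def roots_def simple_reflection_apply\<close>)
  with False show ?thesis by (auto simp: simple_root_def)
qed

text \<open>The symmetric difference formula for u = s_i compares the inversions of w with a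
  one-element set, so the count changes by exactly one.\<close>

lemma card_inversions_comp_simple:
  assumes w: "w \<in> signed_perms n" and i: "i < n"
  shows "card (inversions n (w \<circ> simple_reflection i)) =
    (if simple_root i \<in> inversions n w then card (inversions n w) - 1 else Suc (card (inversions n w)))"
proof -
  have "card (inversions n (w \<circ> simple_reflection i)) =
      card (sym_diff {simple_root i} (inversions n w))"
    using card_inversions_comp_inv[OF simple_reflection_signed[OF i] w]
    by (simp add: inv_simple_reflection inversions_simple_reflection[OF i])
  also have "sym_diff {simple_root i} (inversions n w) =
      (if simple_root i \<in> inversions n w then inversions n w - {simple_root i}
       else insert (simple_root i) (inversions n w))" by auto
  finally show ?thesis by (simp add: finite_inversions comp_def)
qed

lemma descent_exists:
  assumes w: "w \<in> signed_perms n" and "w \<noteq> id"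
  obtains i where "i < n" "simple_root i \<in> inversions n w"
proof -
  obtain i where i: "i < n" "\<not> w (int i) < w (int i + 1)"
    using increasing_signed_perm_eq_id[OF w] assms(2) by blast
  have "simple_root i \<in> inversions n w"
  proof (cases "i = 0")
    case True
    with i signed_perms_zero[OF w] signed_perms_eq_zero_iff[OF w, of 1] show ?thesis
      by (simp add: simple_root_def inversions_def roots_def signed_perms_minus[OF w])
  next
    case False
    with i signed_perms_eq_iff[OF w, of "int i" "int i + 1"] show ?thesis
      by (auto simp: simple_root_def inversions_def roots_def)
  qed
  with i(1) that show thesis by blast
qed

lemma foldr_comp_snoc: "foldr (\<circ>) (gs @ [g]) id = foldr (\<circ>) gs id \<circ> g"
  by (induction gs) (simp_all add: comp_assoc)

text \<open>Stated for a set \<open>W\<close> and an index set \<open>K\<close> so that types A and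
  B share one proof. Removing descents one at a time writes w with as many generators as it has
  inversions; conversely a generator raises the count by at most one. The assumption on descents
  keeps the removal inside \<open>K\<close>.\<close>

lemma coxeter_length_eq_card_inversions:
  assumes W: "W \<subseteq> signed_perms n" and K: "K \<subseteq> {0..<n}"
    and closed: "\<And>w i. w \<in> W \<Longrightarrow> i \<in> K \<Longrightarrow> w \<circ> simple_reflection i \<in> W"
    and descent: "\<And>w i. w \<in> W \<Longrightarrow> i < n \<Longrightarrow> simple_root i \<in> inversions n w \<Longrightarrow> i \<in> K"
    and w: "w \<in> W"
  shows "coxeter_length (simple_reflection ` K) w = card (inversions n w)"
proof -
  have upper: "\<exists>gs. length gs = card (inversions n v) \<and> set gs \<subseteq> simple_reflection ` K \<and>
      foldr (\<circ>) gs id = v" if "v \<in> W" for v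
    using that
  proof (induction "card (inversions n v)" arbitrary: v rule: less_induct)
    case less
    have v: "v \<in> signed_perms n" using W less.prems by blast
    show ?case
    proof (cases "v = id")
      case True
      then show ?thesis by (simp add: inversions_id)
    next
      case False
      then obtain i where i: "i < n" "simple_root i \<in> inversions n v"
        using descent_exists[OF v] by blast
      let ?v = "v \<circ> simple_reflection i"
      have K: "i \<in> K" using descent less.prems i by blast
      have pos: "card (inversions n v) > 0"
        using i(2) by (auto simp: card_gt_0_iff finite_inversions)
      have card: "card (inversions n ?v) = card (inversions n v) - 1"
        using card_inversions_comp_simple[OF v i(1)] i(2) by simp
      with less.hyps[of ?v] pos closed[OF less.prems K]
      obtain gs where gs: "length gs = card (inversions n ?v)" "set gs \<subseteq> simple_reflection ` K"
        "foldr (\<circ>) gs id = ?v" by auto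
      have "foldr (\<circ>) (gs @ [simple_reflection i]) id = v"
        by (simp only: foldr_comp_snoc gs(3) comp_assoc simple_reflection_involution comp_id)
      with gs K card pos show ?thesis
        by (intro exI[of _ "gs @ [simple_reflection i]"]) auto
    qed
  qed
  have lower: "foldr (\<circ>) gs id \<in> signed_perms n \<and> card (inversions n (foldr (\<circ>) gs id)) \<le> length gs"
    if "set gs \<subseteq> simple_reflection ` K" for gs
    using that
  proof (induction gs rule: rev_induct)
    case Nil
    have "foldr (\<circ>) [] id = (id :: int \<Rightarrow> int)" by (rule ext) simp
    then show ?case by (simp only: id_signed_perms inversions_id card.empty le0 simp_thms)
  next
    case (snoc g gs)
    then obtain i where i: "i < n" "g = simple_reflection i" using K by force
    have "set gs \<subseteq> simple_reflection ` K" using snoc.prems by simp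
    define v where "v = foldr (\<circ>) gs id"
    have v: "v \<in> signed_perms n" "card (inversions n v) \<le> length gs"
      using snoc.IH[OF \<open>set gs \<subseteq> _\<close>] by (simp_all only: v_def)
    have foldr_eq: "foldr (\<circ>) (gs @ [g]) id = v \<circ> simple_reflection i"
      by (simp only: foldr_comp_snoc i(2) v_def)
    show ?case
    proof
      show "foldr (\<circ>) (gs @ [g]) id \<in> signed_perms n"
        unfolding foldr_eq by (rule signed_perms_comp[OF v(1) simple_reflection_signed[OF i(1)]])
      show "card (inversions n (foldr (\<circ>) (gs @ [g]) id)) \<le> length (gs @ [g])"
        unfolding foldr_eq card_inversions_comp_simple[OF v(1) i(1)] using v(2) by simp arith
    qed
  qed
  show ?thesis
    unfolding coxeter_length_def
  proof (rule Least_equality)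
    show "\<exists>gs. length gs = card (inversions n w) \<and> set gs \<subseteq> simple_reflection ` K \<and>
        foldr (\<circ>) gs id = w" using upper[OF w] .
    show "card (inversions n w) \<le> k" if "\<exists>gs. length gs = k \<and> set gs \<subseteq> simple_reflection ` K \<and>
        foldr (\<circ>) gs id = w" for k using that lower by blast
  qed
qed

lemma coxeter_length_B:
  "w \<in> signed_perms n \<Longrightarrow> coxeter_length (generators_B n) w = card (inversions n w)"
  unfolding generators_B_def
  by (rule coxeter_length_eq_card_inversions[where W = "signed_perms n"])
    (simp_all add: signed_perms_comp simple_reflection_signed)

text \<open>Positive entries exclude a descent at index 0, so removing descents uses adjacent
  transpositions only and the type B count also gives the type A length.\<close>

lemma coxeter_length_S:
  "w \<in> perms n \<Longrightarrow> coxeter_length (generators_S n) w = card (inversions n w)"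
  unfolding generators_S_def
proof (rule coxeter_length_eq_card_inversions[where W = "perms n"])
  fix v i assume v: "v \<in> perms n" "i < n" "simple_root i \<in> inversions n v"
  have "v (-1) < 0" "v 1 > 0"
    using perms_pos_iff[OF v(1), of 1] signed_perms_minus[OF perms_signed[OF v(1)], of 1] by auto
  with v show "i \<in> {1..<n}" by (cases "i = 0") (auto simp: simple_root_def inversions_def)
qed (auto simp: perms_comp simple_reflection_perms perms_signed)

section \<open>Left weak order as containment of inversion sets\<close>

lemma card_sym_diff_eq_iff_subset:
  assumes "finite A" "finite B"
  shows "card B = card A + card (sym_diff A B) \<longleftrightarrow> A \<subseteq> B"
proof -
  have "card (sym_diff A B) = card (A - B) + card (B - A)"
    using assms by (intro card_Un_disjoint) auto
  moreover have "card A = card (A - B) + card (A \<inter> B)" "card B = card (B - A) + card (A \<inter> B)"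
    using assms by (metis card_Diff_subset_Int Int_commute add.commute card_Int_Diff)+
  moreover have "card (A - B) = 0 \<longleftrightarrow> A \<subseteq> B" using assms by auto
  \<comment> \<open>After cancellation the equation says that twice the size of A - B is
    zero.\<close>
  ultimately show ?thesis by linarith
qed

lemma left_weak_le_B_iff:
  assumes "u \<in> signed_perms n" "w \<in> signed_perms n"
  shows "left_weak_le (generators_B n) u w \<longleftrightarrow> inversions n u \<subseteq> inversions n w"
proof -
  have "w \<circ> inv u \<in> signed_perms n" by (intro signed_perms_comp signed_perms_inv assms)
  then show ?thesis
    unfolding left_weak_le_def
    by (simp only: coxeter_length_B assms card_inversions_comp_inv card_sym_diff_eq_iff_subset
        finite_inversions)
qed

lemma left_weak_le_S_iff:
  assumes "u \<in> perms n" "w \<in> perms n"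
  shows "left_weak_le (generators_S n) u w \<longleftrightarrow> inversions n u \<subseteq> inversions n w"
proof -
  have "w \<circ> inv u \<in> perms n" by (intro perms_comp perms_inv assms)
  then show ?thesis
    unfolding left_weak_le_def
    by (simp only: coxeter_length_S assms[THEN perms_signed] assms card_inversions_comp_inv
        card_sym_diff_eq_iff_subset finite_inversions)
qed

text \<open>Equal inversion sets have empty symmetric difference, so w u^{-1} has no inversion,
  hence no descent, and is the identity.\<close>

lemma inversions_inject:
  assumes u: "u \<in> signed_perms n" and w: "w \<in> signed_perms n"
    and eq: "inversions n u = inversions n w"
  shows "u = w"
proof -
  have "card (inversions n (w \<circ> inv u)) = 0"
    using card_inversions_comp_inv[OF u w] eq by simp
  then have "inversions n (w \<circ> inv u) = {}" using finite_inversions by simp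
  then have *: "w \<circ> inv u = id"
    using descent_exists[of "w \<circ> inv u" n] signed_perms_comp[OF w signed_perms_inv[OF u]] by blast
  show ?thesis
  proof
    fix i
    have "inv u (u i) = i" using signed_perms_bij[OF u] by (simp add: bij_is_inj)
    with fun_cong[OF *, of "u i"] show "u i = w i" by simp
  qed
qed

section \<open>Separable signed permutations\<close>

text \<open>The two conjuncts exclude 3142 and 2413 with letters compared as signed integers, so no
  standardization is involved. The bounds are explicit because words starting at index 0 occur as
  well.\<close>

definition avoids :: "int \<Rightarrow> int \<Rightarrow> (int \<Rightarrow> int) \<Rightarrow> bool" where
  "avoids a b f \<longleftrightarrow> (\<forall>i j k l. a \<le> i \<and> i < j \<and> j < k \<and> k < l \<and> l \<le> b \<longrightarrow>
     \<not> (f j < f l \<and> f l < f i \<and> f i < f k) \<and> \<not> (f k < f i \<and> f i < f l \<and> f l < f j))"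

lemma avoidsD:
  assumes "avoids a b f" "a \<le> i" "i < j" "j < k" "k < l" "l \<le> b"
  shows "\<not> (f j < f l \<and> f l < f i \<and> f i < f k)" "\<not> (f k < f i \<and> f i < f l \<and> f l < f j)"
  using assms unfolding avoids_def by blast+

text \<open>Reversing the order of values exchanges 3142 and 2413.\<close>

lemma avoids_uminus: "avoids a b (\<lambda>i. - f i) \<longleftrightarrow> avoids a b f"
  unfolding avoids_def by (simp only: neg_less_iff_less) blast

text \<open>The shift d = 0 serves restriction to a block and its standardization; d = 1 and d = -1
  pass between the words of w and of its image.\<close>

lemma avoids_shift_mono:
  assumes "avoids a b f" "a \<le> a' + d" "b' + d \<le> b"
    and "\<And>i j. a' \<le> i \<Longrightarrow> i \<le> b' \<Longrightarrow> a' \<le> j \<Longrightarrow> j \<le> b' \<Longrightarrow> g i < g j \<longleftrightarrow> f (i + d) < f (j + d)"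
  shows "avoids a' b' g"
  unfolding avoids_def
proof (intro allI impI)
  fix i j k l assume *: "a' \<le> i \<and> i < j \<and> j < k \<and> k < l \<and> l \<le> b'"
  then have "a \<le> i + d" "i + d < j + d" "j + d < k + d" "k + d < l + d" "l + d \<le> b"
    using assms(2,3) by auto
  note avoidsD[OF assms(1) this]
  with * show "\<not> (g j < g l \<and> g l < g i \<and> g i < g k) \<and> \<not> (g k < g i \<and> g i < g l \<and> g l < g j)"
    by (simp add: assms(4))
qed

section \<open>Splitting positions of separable words\<close>

lemma global_descents_eq: "global_descents n f = global_ascents n (\<lambda>i. - f i)"
  by (simp add: global_descents_def global_ascents_def)

text \<open>A letter x is appended to a word with a global ascent at p. If x exceeds the whole left
  block, p survives. If x is below the left block, it is below everything and m is a global descent.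
  Otherwise avoidance forces the letters of the left block below x to form a prefix, whose end is a
  global ascent.\<close>

lemma global_ascents_Suc:
  assumes av: "avoids 1 (int m + 1) f" and inj: "inj_on f {1..int m + 1}"
    and p: "p \<in> global_ascents m f"
  shows "global_ascents (Suc m) f \<union> global_descents (Suc m) f \<noteq> {}"
proof -
  define x where "x = f (int m + 1)"
  have pm: "1 \<le> p" "p < m" and asc: "\<And>i j. 1 \<le> i \<Longrightarrow> i \<le> int p \<Longrightarrow> int p < j \<Longrightarrow> j \<le> int m \<Longrightarrow> f i < f j"
    using p by (auto simp: global_ascents_def)
  have neq: "f i \<noteq> x" if "1 \<le> i" "i \<le> int m" for i
    using that inj_onD[OF inj, of i "int m + 1"] by (auto simp: x_def)
  have last: "j \<le> int m \<or> j = int m + 1" if "j \<le> int (Suc m)" for j using that by auto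
  consider "\<forall>i\<in>{1..int p}. f i < x" | "\<forall>i\<in>{1..int p}. \<not> f i < x"
    | "\<exists>i\<in>{1..int p}. f i < x" "\<exists>i\<in>{1..int p}. \<not> f i < x" by blast
  then show ?thesis
  proof cases
    case 1
    then have less: "f i < x" if "1 \<le> i" "i \<le> int p" for i using that by simp
    have "f i < f j" if "1 \<le> i" "i \<le> int p" "int p < j" "j \<le> int (Suc m)" for i j
      using last[OF that(4)] asc[of i j] less[of i] that unfolding x_def by metis
    then have "p \<in> global_ascents (Suc m) f"
      using pm by (simp add: global_ascents_def)
    then show ?thesis by blast
  next
    case 2
    have low: "x < f i" if "1 \<le> i" "i \<le> int p" for i
    proof -
      have "\<not> f i < x" using 2 that by simp
      with neq[of i] that pm show ?thesis by auto
    qed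
    have "x < f i" if "1 \<le> i" "i \<le> int m" for i
    proof (cases "i \<le> int p")
      case False
      with asc[of 1 i] low[of 1] that pm show ?thesis by auto
    qed (use low that in auto)
    then have "m \<in> global_descents (Suc m) f"
      using pm by (auto simp: global_descents_def x_def add.commute)
    then show ?thesis by blast
  next
    case 3
    define Q where "Q = {i \<in> {1..int p}. f i < x}"
    have "finite Q" by (rule finite_subset[of _ "{1..int p}"]) (auto simp: Q_def)
    moreover have "Q \<noteq> {}" using 3(1) by (auto simp: Q_def)
    ultimately have fin: "finite Q" "Q \<noteq> {}" .
    define q where "q = Max Q"
    have q: "1 \<le> q" "q \<le> int p" "f q < x" using Max_in[OF fin] by (auto simp: q_def Q_def)
    have le_q: "i \<le> q" if "1 \<le> i" "i \<le> int p" "f i < x" for i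
      using Max_ge[OF fin(1), of i] that by (auto simp: q_def Q_def)
    have below: "f i < x" if "1 \<le> i" "i \<le> q" for i
    proof (rule ccontr)
      assume "\<not> f i < x"
      with that q pm neq[of i] have i: "x < f i" "i < q" by (auto simp: less_le)
      \<comment> \<open>A letter above x before position q would form 3142 at positions i, q, p + 1,
        m + 1.\<close>
      have "\<not> (f q < x \<and> x < f i \<and> f i < f (int p + 1))"
        unfolding x_def using that q pm i by (intro avoidsD(1)[OF av]) auto
      with asc[of i "int p + 1"] that q pm i show False by auto
    qed
    have "q \<noteq> int p"
    proof
      assume "q = int p"
      with below 3(2) show False by auto
    qed
    have "f i < f j" if ij: "1 \<le> i" "i \<le> q" "q < j" "j \<le> int (Suc m)" for i j
    proof -
      consider "j \<le> int p" | "int p < j" "j \<le> int m" | "j = int m + 1" using last[OF ij(4)] by force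
      then show ?thesis
      proof cases
        case 1
        then have "\<not> f j < x" using le_q[of j] ij by auto
        with below[of i] ij show ?thesis by auto
      next
        case 2
        then show ?thesis using asc ij q by auto
      next
        case 3
        then show ?thesis using below[of i] ij by (simp add: x_def)
      qed
    qed
    then have "nat q \<in> global_ascents (Suc m) f"
      using q pm by (auto simp: global_ascents_def)
    then show ?thesis by blast
  qed
qed

text \<open>Induction on the length: the prefix splits by hypothesis and the last letter is
  appended. A global descent of f is a global ascent of - f, and negation keeps avoidance, so only
  ascents need the combinatorial argument.\<close>

lemma global_ascent_or_descent:
  assumes "avoids 1 (int m) f" "inj_on f {1..int m}" "m \<ge> 2"
  shows "global_ascents m f \<union> global_descents m f \<noteq> {}"
  using assms(3,1,2)
proof (induction m rule: dec_induct)
  case base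
  have "f 1 \<noteq> f 2" using inj_onD[OF base(2), of 1 2] by auto
  moreover have "i \<in> {1..int 1} \<longleftrightarrow> i = 1" "j \<in> {int 1 + 1..int 2} \<longleftrightarrow> j = 2" for i j :: int by auto
  ultimately have "1 \<in> global_ascents 2 f \<union> global_descents 2 f"
    by (simp add: global_ascents_def global_descents_def) linarith
  then show ?case by blast
next
  case (step m)
  have av: "avoids 1 (int m + 1) f" and inj: "inj_on f {1..int m + 1}"
    using step.prems by (simp_all add: add.commute)
  have "avoids 1 (int m) f"
    by (rule avoids_shift_mono[where d = 0, OF av]) auto
  moreover have "inj_on f {1..int m}" using inj by (rule inj_on_subset) auto
  ultimately consider p where "p \<in> global_ascents m f" | p where "p \<in> global_descents m f"
    using step.IH by blast
  then show ?case
  proof cases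
    case 1
    then show ?thesis by (rule global_ascents_Suc[OF av inj])
  next
    case 2
    have "global_ascents (Suc m) (\<lambda>i. - f i) \<union> global_descents (Suc m) (\<lambda>i. - f i) \<noteq> {}"
    proof (rule global_ascents_Suc)
      show "avoids 1 (int m + 1) (\<lambda>i. - f i)" using av by (simp only: avoids_uminus)
      show "inj_on (\<lambda>i. - f i) {1..int m + 1}" using inj by (simp add: inj_on_def)
      show "p \<in> global_ascents m (\<lambda>i. - f i)" using 2 by (simp only: global_descents_eq)
    qed
    then show ?thesis by (simp add: global_descents_eq Un_commute)
  qed
qed

section \<open>Ranks, standardization and signed patterns\<close>

lemma card_le_less_iff:
  fixes g :: "'a \<Rightarrow> 'b :: linorder"
  assumes "finite A" "x \<in> A" "y \<in> A"
  shows "card {z \<in> A. g z \<le> g x} < card {z \<in> A. g z \<le> g y} \<longleftrightarrow> g x < g y"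
proof
  assume "g x < g y"
  then have "{z \<in> A. g z \<le> g x} \<subseteq> {z \<in> A. g z \<le> g y}"
    "y \<notin> {z \<in> A. g z \<le> g x}" "y \<in> {z \<in> A. g z \<le> g y}" using assms(3) by auto
  then have "{z \<in> A. g z \<le> g x} \<subset> {z \<in> A. g z \<le> g y}" by blast
  then show "card {z \<in> A. g z \<le> g x} < card {z \<in> A. g z \<le> g y}"
    using assms(1) by (intro psubset_card_mono) auto
next
  assume *: "card {z \<in> A. g z \<le> g x} < card {z \<in> A. g z \<le> g y}"
  show "g x < g y"
  proof (rule ccontr)
    assume "\<not> g x < g y"
    then have "{z \<in> A. g z \<le> g y} \<subseteq> {z \<in> A. g z \<le> g x}" by auto
    then have "card {z \<in> A. g z \<le> g y} \<le> card {z \<in> A. g z \<le> g x}"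
      using assms(1) by (intro card_mono) auto
    with * show False by simp
  qed
qed

lemma sts_pair:
  assumes "\<bar>y\<bar> < \<bar>x\<bar>" shows "sts [x, y] = [2 * sgn x, sgn y]"
proof -
  have "{z \<in> {x, y}. \<bar>z\<bar> \<le> \<bar>x\<bar>} = {x, y}" "{z \<in> {x, y}. \<bar>z\<bar> \<le> \<bar>y\<bar>} = {y}" "x \<noteq> y"
    using assms by auto
  then show ?thesis by (simp add: sts_def)
qed

lemma sts_3142:
  assumes "\<bar>b\<bar> < \<bar>d\<bar>" "\<bar>d\<bar> < \<bar>a\<bar>" "\<bar>a\<bar> < \<bar>c\<bar>"
  shows "sts [a, b, c, d] = [3 * sgn a, sgn b, 4 * sgn c, 2 * sgn d]"
proof -
  let ?A = "{a, b, c, d}"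
  have "{z \<in> ?A. \<bar>z\<bar> \<le> \<bar>a\<bar>} = {a, b, d}" "{z \<in> ?A. \<bar>z\<bar> \<le> \<bar>b\<bar>} = {b}"
    "{z \<in> ?A. \<bar>z\<bar> \<le> \<bar>c\<bar>} = ?A" "{z \<in> ?A. \<bar>z\<bar> \<le> \<bar>d\<bar>} = {b, d}"
    using assms by fastforce+
  moreover have "distinct [a, b, c, d]" using assms by auto
  ultimately show ?thesis by (simp add: sts_def)
qed

lemma sts_2413:
  assumes "\<bar>c\<bar> < \<bar>a\<bar>" "\<bar>a\<bar> < \<bar>d\<bar>" "\<bar>d\<bar> < \<bar>b\<bar>"
  shows "sts [a, b, c, d] = [2 * sgn a, 4 * sgn b, sgn c, 3 * sgn d]"
proof -
  let ?A = "{a, b, c, d}"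
  have "{z \<in> ?A. \<bar>z\<bar> \<le> \<bar>a\<bar>} = {a, c}" "{z \<in> ?A. \<bar>z\<bar> \<le> \<bar>b\<bar>} = ?A"
    "{z \<in> ?A. \<bar>z\<bar> \<le> \<bar>c\<bar>} = {c}" "{z \<in> ?A. \<bar>z\<bar> \<le> \<bar>d\<bar>} = {a, c, d}"
    using assms by fastforce+
  moreover have "distinct [a, b, c, d]" using assms by auto
  ultimately show ?thesis by (simp add: sts_def)
qed

lemma length_sts: "length (sts a) = length a"
  by (simp add: sts_def)

text \<open>Used to read off signs and the order of absolute values from a known pattern. A letter 0
  is sent to 0 by the factor \<open>sgn\<close> whatever its rank, hence the case
  distinction.\<close>

lemma sts_nth_sgn_abs:
  assumes "i < length a"
  shows "sgn (sts a ! i) = sgn (a ! i)"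
    and "j < length a \<Longrightarrow> \<bar>sts a ! i\<bar> < \<bar>sts a ! j\<bar> \<Longrightarrow> \<bar>a ! i\<bar> < \<bar>a ! j\<bar>"
proof -
  let ?r = "\<lambda>x. card {y \<in> set a. \<bar>y\<bar> \<le> \<bar>x\<bar>}"
  have pos: "?r (a ! k) > 0" if "k < length a" for k
    using nth_mem[OF that] by (simp add: card_gt_0_iff) blast
  have nth: "sts a ! k = sgn (a ! k) * int (?r (a ! k))" if "k < length a" for k
    using that by (simp add: sts_def)
  show "sgn (sts a ! i) = sgn (a ! i)"
    using nth[OF assms] pos[OF assms] by (simp add: sgn_mult)
  assume j: "j < length a" and less: "\<bar>sts a ! i\<bar> < \<bar>sts a ! j\<bar>"
  show "\<bar>a ! i\<bar> < \<bar>a ! j\<bar>"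
  proof (cases "a ! i = 0")
    case True
    with less nth[OF j] show ?thesis by (cases "a ! j = 0") auto
  next
    case False
    then have "\<bar>sts a ! i\<bar> = int (?r (a ! i))" using nth[OF assms] by (simp add: abs_mult)
    moreover have "\<bar>sts a ! j\<bar> \<le> int (?r (a ! j))" using nth[OF j] by (simp add: abs_mult sgn_if)
    ultimately have "?r (a ! i) < ?r (a ! j)" using less by linarith
    then show ?thesis using card_le_less_iff[of "set a" "a ! i" "a ! j" abs] assms j by simp
  qed
qed

lemma contains_pattern_pair:
  "contains_pattern n w [c, d] \<longleftrightarrow>
     (\<exists>i j. 1 \<le> i \<and> i < j \<and> j \<le> int n \<and> sts [w i, w j] = [c, d])"
proof
  assume "contains_pattern n w [c, d]"
  then obtain js where js: "sorted_wrt (<) js" "set js \<subseteq> {1..int n}" "sts (map w js) = [c, d]"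
    by (auto simp: contains_pattern_def)
  then have "length js = 2" using length_sts[of "map w js"] by simp
  then obtain i j where "js = [i, j]" by (auto simp: numeral_2_eq_2 length_Suc_conv)
  with js show "\<exists>i j. 1 \<le> i \<and> i < j \<and> j \<le> int n \<and> sts [w i, w j] = [c, d]"
    by (intro exI[of _ i] exI[of _ j]) simp
next
  assume "\<exists>i j. 1 \<le> i \<and> i < j \<and> j \<le> int n \<and> sts [w i, w j] = [c, d]"
  then obtain i j where "1 \<le> i" "i < j" "j \<le> int n" "sts [w i, w j] = [c, d]" by blast
  then show "contains_pattern n w [c, d]"
    unfolding contains_pattern_def by (intro exI[of _ "[i, j]"]) simp
qed

lemma contains_pattern_quadruple:
  "contains_pattern n w [c, d, e, f] \<longleftrightarrow>
     (\<exists>i j k l. 1 \<le> i \<and> i < j \<and> j < k \<and> k < l \<and> l \<le> int n \<and>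
       sts [w i, w j, w k, w l] = [c, d, e, f])"
proof
  assume "contains_pattern n w [c, d, e, f]"
  then obtain js where js: "sorted_wrt (<) js" "set js \<subseteq> {1..int n}" "sts (map w js) = [c, d, e, f]"
    by (auto simp: contains_pattern_def)
  then have "length js = 4" using length_sts[of "map w js"] by simp
  then obtain i j k l where "js = [i, j, k, l]" by (auto simp: numeral_eq_Suc length_Suc_conv)
  with js show "\<exists>i j k l. 1 \<le> i \<and> i < j \<and> j < k \<and> k < l \<and> l \<le> int n \<and>
      sts [w i, w j, w k, w l] = [c, d, e, f]"
    by (intro exI[of _ i] exI[of _ j] exI[of _ k] exI[of _ l]) simp
next
  assume "\<exists>i j k l. 1 \<le> i \<and> i < j \<and> j < k \<and> k < l \<and> l \<le> int n \<and>
      sts [w i, w j, w k, w l] = [c, d, e, f]"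
  then obtain i j k l where "1 \<le> i" "i < j" "j < k" "k < l" "l \<le> int n"
    "sts [w i, w j, w k, w l] = [c, d, e, f]" by blast
  then show "contains_pattern n w [c, d, e, f]"
    unfolding contains_pattern_def by (intro exI[of _ "[i, j, k, l]"]) simp
qed

definition last_dominates :: "nat \<Rightarrow> (int \<Rightarrow> int) \<Rightarrow> bool" where
  "last_dominates n v \<longleftrightarrow>
     (\<forall>i j. 1 \<le> i \<and> i < j \<and> j \<le> int n \<longrightarrow> (v i + v j < 0 \<longleftrightarrow> v j < 0))"

lemma last_dominatesD:
  "last_dominates n v \<Longrightarrow> 1 \<le> i \<Longrightarrow> i < j \<Longrightarrow> j \<le> int n \<Longrightarrow> v i + v j < 0 \<longleftrightarrow> v j < 0"
  by (simp add: last_dominates_def)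

text \<open>Once \<open>last_dominates\<close> holds, an occurrence of 3142 or 2413 in the order of
  signed values cannot mix signs. If all four letters are positive it is an occurrence of the same
  pattern; if all are negative, taking absolute values exchanges the two, which yields the barred
  patterns.\<close>

lemma separable_B_iff:
  "w \<in> separable_B n \<longleftrightarrow> w \<in> signed_perms n \<and> last_dominates n w \<and> avoids 1 (int n) w"
proof (intro iffI conjI)
  assume sep: "w \<in> separable_B n"
  then show w: "w \<in> signed_perms n" by (simp add: separable_B_def)
  have nonzero: "w i \<noteq> 0" if "1 \<le> i" for i using signed_perms_eq_zero_iff[OF w] that by auto
  have no2: "sts [w i, w j] \<notin> {[-2, 1], [2, -1]}" if "1 \<le> i" "i < j" "j \<le> int n" for i j
    using sep that unfolding separable_B_def ball_simps contains_pattern_pair by blast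
  have no4: "sts [w i, w j, w k, w l] \<notin> {[3, 1, 4, 2], [2, 4, 1, 3], [-3, -1, -4, -2], [-2, -4, -1, -3]}"
    if "1 \<le> i" "i < j" "j < k" "k < l" "l \<le> int n" for i j k l
    using sep that unfolding separable_B_def ball_simps contains_pattern_quadruple by blast
  show dom: "last_dominates n w"
    unfolding last_dominates_def
  proof (intro allI impI)
    fix i j assume *: "1 \<le> i \<and> i < j \<and> j \<le> int n"
    have "\<bar>w i\<bar> \<noteq> \<bar>w j\<bar>" using signed_perms_abs_eq[OF w, of i j] * by auto
    then consider "\<bar>w i\<bar> < \<bar>w j\<bar>" | "\<bar>w j\<bar> < \<bar>w i\<bar>" by linarith
    then show "w i + w j < 0 \<longleftrightarrow> w j < 0"
    proof cases
      case 2
      with no2[of i j] nonzero[of i] nonzero[of j] * have "sgn (w i) = sgn (w j)"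
        by (auto simp: sts_pair sgn_if split: if_splits)
      then show ?thesis by (simp add: sgn_if split: if_splits)
    qed linarith
  qed
  show "avoids 1 (int n) w"
    unfolding avoids_def
  proof (intro allI impI)
    fix i j k l assume *: "1 \<le> i \<and> i < j \<and> j < k \<and> k < l \<and> l \<le> int n"
    define a b c d where abcd: "a = w i" "b = w j" "c = w k" "d = w l"
    have nz: "a \<noteq> 0" "b \<noteq> 0" "c \<noteq> 0" "d \<noteq> 0" using nonzero * by (auto simp: abcd)
    have D: "a + b < 0 \<longleftrightarrow> b < 0" "a + c < 0 \<longleftrightarrow> c < 0" "a + d < 0 \<longleftrightarrow> d < 0" "b + c < 0 \<longleftrightarrow> c < 0"
      "b + d < 0 \<longleftrightarrow> d < 0" "c + d < 0 \<longleftrightarrow> d < 0"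
      using * unfolding abcd by (intro last_dominatesD[OF dom]; simp)+
    note no = no4[of i j k l, folded abcd]
    have "\<not> (b < d \<and> d < a \<and> a < c)"
    proof
      assume o: "b < d \<and> d < a \<and> a < c"
      \<comment> \<open>Here b is smallest and c largest. If b < 0 < c, then b + c \<ge> 0. A
        negative d would give c + d < 0, contradicting b < d; a positive d gives b + d \<ge> 0,
        while a + b < 0 contradicts d < a.\<close>
      have "b > 0 \<or> c < 0" using o D nz by linarith
      then show False using no * o by (auto simp: sts_3142 sts_2413)
    qed
    moreover have "\<not> (c < a \<and> a < d \<and> d < b)"
    proof
      assume o: "c < a \<and> a < d \<and> d < b"
      \<comment> \<open>Now c is smallest and b largest. If c < 0 < b, then b + c < 0 and a + b
        \<ge> 0. A positive d gives c + d \<ge> 0, contradicting d < b; a negative d gives b + d <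
        0, contradicting a < d.\<close>
      have "c > 0 \<or> b < 0" using o D nz by linarith
      then show False using no * o by (auto simp: sts_3142 sts_2413)
    qed
    ultimately show "\<not> (w j < w l \<and> w l < w i \<and> w i < w k) \<and> \<not> (w k < w i \<and> w i < w l \<and> w l < w j)"
      by (simp add: abcd)
  qed
next
  assume w: "w \<in> signed_perms n \<and> last_dominates n w \<and> avoids 1 (int n) w"
  have "\<not> contains_pattern n w [-2, 1]" "\<not> contains_pattern n w [2, -1]"
    unfolding contains_pattern_pair
  proof (safe)
    fix i j assume *: "1 \<le> i" "i < j" "j \<le> int n"
    have "w i + w j < 0 \<longleftrightarrow> w j < 0" using w * last_dominatesD by blast
    note nth = sts_nth_sgn_abs(1)[of 0 "[w i, w j]"] sts_nth_sgn_abs(1)[of 1 "[w i, w j]"]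
      sts_nth_sgn_abs(2)[of 1 "[w i, w j]" 0] \<open>w i + w j < 0 \<longleftrightarrow> w j < 0\<close>
    show False if "sts [w i, w j] = [-2, 1]" using nth that by (simp add: sgn_if split: if_splits)
    show False if "sts [w i, w j] = [2, -1]" using nth that by (simp add: sgn_if split: if_splits)
  qed
  moreover have "\<not> contains_pattern n w [3, 1, 4, 2]" "\<not> contains_pattern n w [2, 4, 1, 3]"
    "\<not> contains_pattern n w [-3, -1, -4, -2]" "\<not> contains_pattern n w [-2, -4, -1, -3]"
    unfolding contains_pattern_quadruple
  proof (safe)
    fix i j k l assume *: "1 \<le> i" "i < j" "j < k" "k < l" "l \<le> int n"
    define a where "a = [w i, w j, w k, w l]"
    note nth = sts_nth_sgn_abs(1)[of 0 a] sts_nth_sgn_abs(1)[of 1 a] sts_nth_sgn_abs(1)[of 2 a]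
      sts_nth_sgn_abs(1)[of 3 a]
    note av = avoidsD[of 1 "int n" w, OF _ *]
    show False if "sts [w i, w j, w k, w l] = [3, 1, 4, 2]"
      using nth sts_nth_sgn_abs(2)[of 1 a 3] sts_nth_sgn_abs(2)[of 3 a 0] sts_nth_sgn_abs(2)[of 0 a 2]
        that av w by (simp add: a_def sgn_if split: if_splits)
    show False if "sts [w i, w j, w k, w l] = [2, 4, 1, 3]"
      using nth sts_nth_sgn_abs(2)[of 2 a 0] sts_nth_sgn_abs(2)[of 0 a 3] sts_nth_sgn_abs(2)[of 3 a 1]
        that av w by (simp add: a_def sgn_if split: if_splits)
    show False if "sts [w i, w j, w k, w l] = [-3, -1, -4, -2]"
      using nth sts_nth_sgn_abs(2)[of 1 a 3] sts_nth_sgn_abs(2)[of 3 a 0] sts_nth_sgn_abs(2)[of 0 a 2]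
        that av w by (simp add: a_def sgn_if split: if_splits)
    show False if "sts [w i, w j, w k, w l] = [-2, -4, -1, -3]"
      using nth sts_nth_sgn_abs(2)[of 2 a 0] sts_nth_sgn_abs(2)[of 0 a 3] sts_nth_sgn_abs(2)[of 3 a 1]
        that av w by (simp add: a_def sgn_if split: if_splits)
  qed
  ultimately show "w \<in> separable_B n" using w by (simp add: separable_B_def)
qed

lemma separable_S_iff: "w \<in> separable_S m \<longleftrightarrow> w \<in> perms m \<and> avoids 1 (int m) w"
proof -
  have "last_dominates m w" if "w \<in> perms m"
    unfolding last_dominates_def
  proof (intro allI impI)
    fix i j assume "1 \<le> i \<and> i < j \<and> j \<le> int m"
    with perms_pos_iff[OF that, of i] perms_pos_iff[OF that, of j]
    show "w i + w j < 0 \<longleftrightarrow> w j < 0" by linarith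
  qed
  then show ?thesis using perms_signed by (auto simp: separable_S_def separable_B_iff)
qed

section \<open>The map \<open>\<phi>\<close>\<close>

text \<open>The entries of \<open>\<phi> w\<close>, preceded by \<open>0\<close>, are in the same relative order as those of \<open>w\<close>,
  which shifts the index by one.\<close>

definition phi_rel :: "nat \<Rightarrow> (int \<Rightarrow> int) \<Rightarrow> (int \<Rightarrow> int) \<Rightarrow> bool" where
  "phi_rel n w v \<longleftrightarrow> v \<in> signed_perms n \<and> last_dominates n v \<and>
     (\<forall>i j. 0 \<le> i \<and> i < j \<and> j \<le> int n \<longrightarrow> (v j < v i \<longleftrightarrow> w (j + 1) < w (i + 1)))"

lemma phi_relD:
  assumes "phi_rel n w v"
  shows "v \<in> signed_perms n" "last_dominates n v"
    "0 \<le> i \<Longrightarrow> i < j \<Longrightarrow> j \<le> int n \<Longrightarrow> v j < v i \<longleftrightarrow> w (j + 1) < w (i + 1)"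
  using assms by (auto simp: phi_rel_def)

text \<open>For i < 0 the root is e_j or e_j + e_{-i}. By \<open>last_dominates\<close> either one
  is an inversion iff v j < 0 = v 0, so every negative i may be replaced by the index 0; this is the
  \<open>max\<close>.\<close>

lemma phi_rel_inversions_iff:
  assumes rel: "phi_rel n w v" and ij: "(i, j) \<in> roots n"
  shows "(i, j) \<in> inversions n v \<longleftrightarrow> w (j + 1) < w (max i 0 + 1)"
proof (cases "i > 0")
  case True
  with phi_relD(3)[OF rel, of i j] ij show ?thesis by (auto simp: inversions_def roots_def)
next
  case False
  note v = phi_relD(1)[OF rel]
  have "v i = - v (- i)" by (simp add: signed_perms_minus[OF v])
  moreover have "v (- i) + v j < 0 \<longleftrightarrow> v j < 0"
    using last_dominatesD[OF phi_relD(2)[OF rel], of "- i" j] False ij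
    by (cases "j = - i") (auto simp: roots_def)
  ultimately have "(i, j) \<in> inversions n v \<longleftrightarrow> v j < v 0"
    using ij by (auto simp: inversions_def signed_perms_zero[OF v])
  with phi_relD(3)[OF rel, of 0 j] False ij show ?thesis by (auto simp: roots_def)
qed

lemma phi_rel_inversions_subset_iff:
  assumes "phi_rel n w v" "phi_rel n w' v'"
  shows "inversions n v \<subseteq> inversions n v' \<longleftrightarrow>
    (\<forall>i j. 0 \<le> i \<and> i < j \<and> j \<le> int n \<longrightarrow> w (j + 1) < w (i + 1) \<longrightarrow> w' (j + 1) < w' (i + 1))"
    (is "?L \<longleftrightarrow> ?R")
proof
  assume L: ?L
  show ?R
  proof (intro allI impI)
    fix i j assume *: "0 \<le> i \<and> i < j \<and> j \<le> int n" "w (j + 1) < w (i + 1)"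
    \<comment> \<open>Index 0 does not occur in \<open>roots\<close>; the pair (- j, j), that is
      e_j, represents the comparison with the leading 0.\<close>
    define k where "k = (if i = 0 then - j else i)"
    have k: "(k, j) \<in> roots n" "max k 0 = i" using * by (auto simp: k_def roots_def)
    with L * show "w' (j + 1) < w' (i + 1)"
      using phi_rel_inversions_iff[OF assms(1) k(1)] phi_rel_inversions_iff[OF assms(2) k(1)] by auto
  qed
next
  assume R: ?R
  show ?L
  proof
    fix r assume r: "r \<in> inversions n v"
    obtain i j where ij: "r = (i, j)" by force
    with r have root: "(i, j) \<in> roots n" by (simp add: inversions_def)
    then have "0 \<le> max i 0 \<and> max i 0 < j \<and> j \<le> int n" by (auto simp: roots_def)
    with r R show "r \<in> inversions n v'"
      unfolding ij phi_rel_inversions_iff[OF assms(1) root] phi_rel_inversions_iff[OF assms(2) root]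
      by blast
  qed
qed

text \<open>w alone decides which roots are inversions of v, and inversions determine v. This is
  what makes the recursion independent of the splitting position.\<close>

lemma phi_rel_unique: "phi_rel n w v \<Longrightarrow> phi_rel n w v' \<Longrightarrow> v = v'"
  using phi_rel_inversions_subset_iff[of n w v w v'] phi_rel_inversions_subset_iff[of n w v' w v]
  by (intro inversions_inject[of v n v'] equalityI) (auto dest: phi_relD(1))

text \<open>Counting indices from 0 makes the right-hand side literally that of
  \<open>phi_rel_inversions_subset_iff\<close>. Pairs with negative first index contribute nothing,
  as w preserves signs.\<close>

lemma perms_inversions_subset_iff:
  assumes w: "w \<in> perms (n + 1)" and w': "w' \<in> perms (n + 1)"
  shows "inversions (n + 1) w \<subseteq> inversions (n + 1) w' \<longleftrightarrow>
    (\<forall>i j. 0 \<le> i \<and> i < j \<and> j \<le> int n \<longrightarrow> w (j + 1) < w (i + 1) \<longrightarrow> w' (j + 1) < w' (i + 1))"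
    (is "?L \<longleftrightarrow> ?R")
proof
  assume L: ?L
  show ?R
  proof (intro allI impI)
    fix i j assume "0 \<le> i \<and> i < j \<and> j \<le> int n" "w (j + 1) < w (i + 1)"
    then have "(i + 1, j + 1) \<in> inversions (n + 1) w" by (simp add: inversions_def roots_def)
    with L show "w' (j + 1) < w' (i + 1)" by (auto simp: inversions_def)
  qed
next
  assume R: ?R
  show ?L
  proof
    fix r assume r: "r \<in> inversions (n + 1) w"
    obtain i j where ij: "r = (i, j)" by force
    with r have *: "(i, j) \<in> roots (n + 1)" "w j < w i" by (auto simp: inversions_def)
    then have "i > 0" using perms_pos_iff[OF w, of i] perms_pos_iff[OF w, of j] by (auto simp: roots_def)
    with * R[rule_format, of "i - 1" "j - 1"] show "r \<in> inversions (n + 1) w'"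
      by (auto simp: ij inversions_def roots_def)
  qed
qed

text \<open>One step of the recursion for \<open>\<phi>\<close>, for both kinds of splitting positions: the constant \<open>c\<close>
  is \<open>1\<close> for a global ascent and \<open>n + 1\<close> for a global descent.\<close>

lemma phi_rel_extend:
  assumes w: "w \<in> perms (n + 1)" and p: "1 \<le> p" "p \<le> n"
    and x: "phi_rel (p - 1) w' x"
    and w': "\<And>i j. 1 \<le> i \<Longrightarrow> i \<le> int p \<Longrightarrow> 1 \<le> j \<Longrightarrow> j \<le> int p \<Longrightarrow> w' i < w' j \<longleftrightarrow> w i < w j"
    and odd: "\<And>i. v (- i) = - v i" and out: "\<And>i. i > int n \<Longrightarrow> v i = i"
    and low: "\<And>i. 0 \<le> i \<Longrightarrow> i < int p \<Longrightarrow> v i = x i"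
    and high: "\<And>i. int p \<le> i \<Longrightarrow> i \<le> int n \<Longrightarrow>
      v i = w (i + 1) - c \<and> int p \<le> \<bar>v i\<bar> \<and> \<bar>v i\<bar> \<le> int n"
    and sgn: "\<And>i j. 0 \<le> i \<Longrightarrow> i < int p \<Longrightarrow> int p \<le> j \<Longrightarrow> j \<le> int n \<Longrightarrow>
      v j < 0 \<longleftrightarrow> w (j + 1) < w (i + 1)"
    and const: "\<And>i j. int p \<le> i \<Longrightarrow> i \<le> int n \<Longrightarrow> int p \<le> j \<Longrightarrow> j \<le> int n \<Longrightarrow> v i < 0 \<longleftrightarrow> v j < 0"
  shows "phi_rel n w v"
proof -
  note xs = phi_relD(1)[OF x]
  \<comment> \<open>Inner entries have absolute value below p and outer ones at least p, so in every
    sum or comparison of the two the sign of the outer entry decides.\<close>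
  have x_bound: "\<bar>x i\<bar> < int p" if "\<bar>i\<bar> < int p" for i
    using that signed_perms_abs_le_iff[OF xs, of i] p by (simp add: of_nat_diff)
  have v: "v \<in> signed_perms n"
  proof (rule signed_permsI[OF odd out])
    fix i assume i: "1 \<le> i" "i \<le> int n"
    show "1 \<le> \<bar>v i\<bar> \<and> \<bar>v i\<bar> \<le> int n"
    proof (cases "i < int p")
      case True
      have "x i \<noteq> 0" using i by (simp add: signed_perms_eq_zero_iff[OF xs])
      with x_bound[of i] True low[of i] i p show ?thesis by auto
    qed (use high[of i] i p in auto)
  next
    fix i j assume ij: "1 \<le> i" "i < j" "j \<le> int n"
    consider "j < int p" | "i < int p" "int p \<le> j" | "int p \<le> i" by linarith
    then show "\<bar>v i\<bar> \<noteq> \<bar>v j\<bar>"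
    proof cases
      case 1
      with signed_perms_abs_eq[OF xs, of i j] low[of i] low[of j] ij show ?thesis by auto
    next
      case 2
      with x_bound[of i] low[of i] high[of j] ij show ?thesis by auto
    next
      case 3
      then have "v i \<noteq> v j"
        using high[of i] high[of j] ij signed_perms_eq_iff[OF perms_signed[OF w], of "i + 1" "j + 1"]
        by auto
      \<comment> \<open>All outer entries share one sign, so distinct values have distinct absolute
        values.\<close>
      with const[of i j] 3 ij show ?thesis by auto
    qed
  qed
  moreover have "last_dominates n v"
    unfolding last_dominates_def
  proof (intro allI impI, elim conjE)
    fix i j assume ij: "1 \<le> i" "i < j" "j \<le> int n"
    consider "j < int p" | "i < int p" "int p \<le> j" | "int p \<le> i" by linarith
    then show "v i + v j < 0 \<longleftrightarrow> v j < 0"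
    proof cases
      case 1
      with last_dominatesD[OF phi_relD(2)[OF x], of i j] low[of i] low[of j] ij p
      show ?thesis by (simp add: of_nat_diff)
    next
      case 2
      with x_bound[of i] low[of i] high[of j] ij show ?thesis by auto
    next
      case 3
      with const[of i j] high[of i] high[of j] ij p show ?thesis by auto
    qed
  qed
  moreover have "v j < v i \<longleftrightarrow> w (j + 1) < w (i + 1)" if ij: "0 \<le> i" "i < j" "j \<le> int n" for i j
  proof -
    consider "j < int p" | "i < int p" "int p \<le> j" | "int p \<le> i" by linarith
    then show ?thesis
    proof cases
      case 1
      with phi_relD(3)[OF x, of i j] low[of i] low[of j] w'[of "j + 1" "i + 1"] ij p
      show ?thesis by (simp add: of_nat_diff)
    next
      case 2
      with x_bound[of i] low[of i] high[of j] sgn[of i j] ij show ?thesis by auto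
    next
      case 3
      with high[of i] high[of j] ij show ?thesis by auto
    qed
  qed
  ultimately show ?thesis by (auto simp: phi_rel_def)
qed

section \<open>Words, blocks of values and the two recursive steps\<close>

lemma of_word_minus: "of_word a (- i) = - of_word a i"
  by (auto simp: of_word_def)

lemma of_word_outside: "\<bar>i\<bar> > int (length a) \<Longrightarrow> of_word a i = i"
  by (simp add: of_word_def)

lemma of_word_nth: "1 \<le> i \<Longrightarrow> i \<le> int (length a) \<Longrightarrow> of_word a i = a ! nat (i - 1)"
  by (simp add: of_word_def)

lemma length_word: "a \<le> b + 1 \<Longrightarrow> length (word w a b) = b + 1 - a"
  by (simp add: word_def)

lemma set_word: "set (word w a b) = w ` {int a..int b}"
  by (simp add: word_def)

lemma of_word_word:
  assumes "1 \<le> i" "i + int a \<le> int b + 1"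
  shows "of_word (word w a b) i = w (i + int a - 1)"
  using assms by (subst of_word_nth) (auto simp: word_def algebra_simps)

text \<open>When the letters fill an interval, the rank of x counts c + 1, ..., x, so standardizing
  is a translation. Blocks at a splitting position are of this kind.\<close>

lemma st_shift:
  assumes "set a = {c + 1..d}" shows "st a = map (\<lambda>x. x - c) a"
proof -
  have "int (card {y \<in> set a. y \<le> x}) = x - c" if "x \<in> set a" for x
  proof -
    have "{y \<in> set a. y \<le> x} = {c + 1..x}" using that unfolding assms by auto
    then show ?thesis using that unfolding assms by auto
  qed
  then show ?thesis by (simp add: st_def)
qed

lemma of_word_map:
  "1 \<le> i \<Longrightarrow> i \<le> int (length a) \<Longrightarrow> of_word (map f a) i = f (of_word a i)"
  by (simp add: of_word_nth)

lemma of_word_st_word: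
  assumes "w ` {int a..int b} = {c + 1..d}" "1 \<le> i" "i + int a \<le> int b + 1"
  shows "of_word (st (word w a b)) i = w (i + int a - 1) - c"
  using assms st_shift[of "word w a b" c d]
  by (simp add: set_word of_word_map length_word of_word_word of_nat_diff)

text \<open>Gives the value sets of the two blocks at a splitting position, with A the block of
  smaller values. A number missing below the maximum of A would lie in B, yet B lies above that
  maximum.\<close>

lemma initial_segment_split:
  fixes A B :: "int set"
  assumes un: "A \<union> B = {1..int m}" and less: "\<And>a b. a \<in> A \<Longrightarrow> b \<in> B \<Longrightarrow> a < b"
  shows "A = {1..int (card A)}" "B = {int (card A) + 1..int m}"
proof -
  have sub: "A \<subseteq> {1..int m}" using un by blast
  then have fin: "finite A" by (rule finite_subset) simp
  have "\<exists>k\<ge>0. A = {1..k}"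
  proof (cases "A = {}")
    case True
    then show ?thesis by (intro exI[of _ 0]) auto
  next
    case False
    then have max: "Max A \<in> A" "\<And>a. a \<in> A \<Longrightarrow> a \<le> Max A" using fin by auto
    have max_m: "Max A \<in> {1..int m}" using max(1) sub by blast
    have "y \<in> A" if "1 \<le> y" "y \<le> Max A" for y
    proof -
      from max_m have "y \<in> A \<union> B" unfolding un using that by simp
      with less[OF max(1), of y] that show ?thesis by auto
    qed
    then have "A = {1..Max A}" using max(2) sub by fastforce
    with max_m show ?thesis by (intro exI[of _ "Max A"]) simp
  qed
  then obtain k where k: "k \<ge> 0" "A = {1..k}" by blast
  then have card: "int (card A) = k" by simp
  then show A: "A = {1..int (card A)}" using k by simp
  have "A \<inter> B = {}" using less by fastforce
  then have "B = {1..int m} - A" using un by blast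
  also have "\<dots> = {k + 1..int m}" using k by auto
  finally show "B = {int (card A) + 1..int m}" using card by simp
qed

lemma global_ascents_image:
  assumes w: "w \<in> perms m" and p: "p \<in> global_ascents m w"
  shows "w ` {1..int p} = {1..int p}" "w ` {int p + 1..int m} = {int p + 1..int m}"
proof -
  have pm: "p < m" using p by (simp add: global_ascents_def)
  have "w ` {1..int p} \<union> w ` {int p + 1..int m} = w ` {1..int m}"
    using pm by (subst image_Un[symmetric]) (rule arg_cong[of _ _ "image w"], auto)
  then have un: "w ` {1..int p} \<union> w ` {int p + 1..int m} = {1..int m}"
    by (simp add: perms_image[OF w])
  have less: "a < b" if "a \<in> w ` {1..int p}" "b \<in> w ` {int p + 1..int m}" for a b
    using p that by (auto simp: global_ascents_def)
  have "card (w ` {1..int p}) = p"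
    using signed_perms_eq_iff[OF perms_signed[OF w]] by (subst card_image) (auto simp: inj_on_def)
  then show "w ` {1..int p} = {1..int p}" "w ` {int p + 1..int m} = {int p + 1..int m}"
    using initial_segment_split[OF un less] by simp_all
qed

lemma global_descents_image:
  assumes w: "w \<in> perms m" and p: "p \<in> global_descents m w"
  shows "w ` {1..int p} = {int (m - p) + 1..int m}" "w ` {int p + 1..int m} = {1..int (m - p)}"
proof -
  have pm: "p < m" using p by (simp add: global_descents_def)
  have "w ` {int p + 1..int m} \<union> w ` {1..int p} = w ` {1..int m}"
    using pm by (subst image_Un[symmetric]) (rule arg_cong[of _ _ "image w"], auto)
  then have un: "w ` {int p + 1..int m} \<union> w ` {1..int p} = {1..int m}"
    by (simp add: perms_image[OF w])
  have less: "a < b" if "a \<in> w ` {int p + 1..int m}" "b \<in> w ` {1..int p}" for a b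
    using p that by (auto simp: global_descents_def)
  have "card (w ` {int p + 1..int m}) = m - p"
    using signed_perms_eq_iff[OF perms_signed[OF w]] pm
    by (subst card_image) (auto simp: inj_on_def)
  then show "w ` {1..int p} = {int (m - p) + 1..int m}" "w ` {int p + 1..int m} = {1..int (m - p)}"
    using initial_segment_split[OF un less] by simp_all
qed

lemma longest_S_apply:
  "1 \<le> i \<Longrightarrow> i \<le> int m \<Longrightarrow> longest_S m i = int m + 1 - i"
  by (simp add: longest_S_def of_word_nth rev_nth nat_diff_distrib)

lemma longest_B_apply: "1 \<le> i \<Longrightarrow> i \<le> int m \<Longrightarrow> longest_B m i = - i"
  by (simp add: longest_B_def of_word_map of_word_nth)

lemma longest_minus: "longest_S m (- i) = - longest_S m i" "longest_B m (- i) = - longest_B m i"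
  by (simp_all only: longest_S_def longest_B_def of_word_minus)

lemma longest_outside:
  "\<bar>i\<bar> > int m \<Longrightarrow> longest_S m i = i" "\<bar>i\<bar> > int m \<Longrightarrow> longest_B m i = i"
  by (simp_all add: longest_S_def longest_B_def of_word_outside)

lemma oplus_minus:
  assumes "\<And>i. u (- i) = - u i" "\<And>i. v (- i) = - v i"
  shows "oplus p u v (- i) = - oplus p u v i"
proof -
  have "- i - sgn (- i) * int p = - (i - sgn i * int p)" by (simp add: algebra_simps)
  then show ?thesis by (simp only: oplus_def abs_minus_cancel assms sgn_minus) (simp add: algebra_simps)
qed

lemma oplus_high:
  "i > int p \<Longrightarrow> oplus p u v i = v (i - int p) + sgn (v (i - int p)) * int p"
  by (simp add: oplus_def)

lemma phi_rel_asc: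
  assumes w: "w \<in> perms (n + 1)" and p: "p \<in> global_ascents (n + 1) w"
    and x: "phi_rel (p - 1) (of_word (word w 1 p)) x"
  shows "phi_rel n w (oplus (p - 1) x (of_word (st (word w (p + 1) (n + 1)))))" (is "phi_rel n w ?v")
proof -
  have pn: "1 \<le> p" "p \<le> n" using p by (auto simp: global_ascents_def)
  let ?y = "of_word (st (word w (p + 1) (n + 1)))"
  have len: "length (st (word w (p + 1) (n + 1))) = n + 1 - p"
    using pn by (simp add: st_def length_word)
  note img = global_ascents_image[OF w p]
  have rng: "int p + 1 \<le> w (i + 1) \<and> w (i + 1) \<le> int n + 1" if "int p \<le> i" "i \<le> int n" for i
  proof -
    have "w (i + 1) \<in> w ` {int p + 1..int (n + 1)}" using that by simp
    then show ?thesis unfolding img(2) by simp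
  qed
  have y: "?y i = w (i + int p) - int p" if "1 \<le> i" "i + int p \<le> int n + 1" for i
    using of_word_st_word[of w "p + 1" "n + 1" "int p" "int (n + 1)" i] img(2) that
    by (simp add: algebra_simps)
  \<comment> \<open>Standardizing subtracts p, and the direct sum adds p - 1 to these positive
    entries.\<close>
  have high: "?v i = w (i + 1) - 1" if "int p \<le> i" "i \<le> int n" for i
    using oplus_high[of "p - 1" i x ?y] y[of "i - int (p - 1)"] rng[OF that] that pn
    by (simp add: of_nat_diff)
  show ?thesis
  proof (rule phi_rel_extend[OF w pn x, where c = 1])
    show "of_word (word w 1 p) i < of_word (word w 1 p) j \<longleftrightarrow> w i < w j"
      if "1 \<le> i" "i \<le> int p" "1 \<le> j" "j \<le> int p" for i j
      using that by (simp add: of_word_word)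
    show "?v (- i) = - ?v i" for i
      by (rule oplus_minus) (simp_all only: of_word_minus signed_perms_minus[OF phi_relD(1)[OF x]])
    show "?v i = i" if "i > int n" for i
    proof -
      have "?y (i - int (p - 1)) = i - int (p - 1)"
        using that pn by (intro of_word_outside) (unfold len, linarith)
      then show ?thesis
        using that pn oplus_high[of "p - 1" i x ?y] by (simp add: of_nat_diff)
    qed
    show "?v i = x i" if "0 \<le> i" "i < int p" for i
      using that pn by (simp add: oplus_def of_nat_diff)
    show "?v i = w (i + 1) - 1 \<and> int p \<le> \<bar>?v i\<bar> \<and> \<bar>?v i\<bar> \<le> int n" if "int p \<le> i" "i \<le> int n" for i
      using high[OF that] rng[OF that] by auto
    show "?v j < 0 \<longleftrightarrow> w (j + 1) < w (i + 1)"
      if "0 \<le> i" "i < int p" "int p \<le> j" "j \<le> int n" for i j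
    proof -
      have "w (i + 1) < w (j + 1)" using p that by (simp add: global_ascents_def)
      with high[OF that(3,4)] rng[OF that(3,4)] show ?thesis by simp
    qed
    show "?v i < 0 \<longleftrightarrow> ?v j < 0"
      if "int p \<le> i" "i \<le> int n" "int p \<le> j" "j \<le> int n" for i j
      using high[OF that(1,2)] high[OF that(3,4)] rng[OF that(1,2)] rng[OF that(3,4)] by simp
  qed
qed

lemma phi_rel_desc:
  assumes w: "w \<in> perms (n + 1)" and p: "p \<in> global_descents (n + 1) w"
    and x: "phi_rel (p - 1) (of_word (st (word w 1 p))) x"
  shows "phi_rel n w (oplus (p - 1) x
    (longest_B (n + 1 - p) \<circ> longest_S (n + 1 - p) \<circ> of_word (word w (p + 1) (n + 1))))"
    (is "phi_rel n w ?v")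
proof -
  have pn: "1 \<le> p" "p \<le> n" using p by (auto simp: global_descents_def)
  let ?m = "n + 1 - p"
  let ?y = "longest_B ?m \<circ> longest_S ?m \<circ> of_word (word w (p + 1) (n + 1))"
  have len: "length (word w (p + 1) (n + 1)) = ?m"
    using pn by (simp add: length_word)
  note img = global_descents_image[OF w p]
  have rng: "1 \<le> w (i + 1) \<and> w (i + 1) \<le> int n + 1 - int p" if "int p \<le> i" "i \<le> int n" for i
  proof -
    have "w (i + 1) \<in> w ` {int p + 1..int (n + 1)}" using that by simp
    then show ?thesis unfolding img(2) using pn by (simp add: of_nat_diff)
  qed
  \<comment> \<open>The product of the longest elements sends x to - (m + 1 - x) = x - (m + 1),
    where m + 1 = n + 2 - p.\<close>
  have y: "?y i = w (i + int p) - (int n + 2 - int p)" if "1 \<le> i" "i + int p \<le> int n + 1" for i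
    using of_word_word[of i "p + 1" "n + 1" w] rng[of "i + int p - 1"] that pn
    by (simp add: longest_S_apply longest_B_apply of_nat_diff algebra_simps)
  \<comment> \<open>These entries are negative, so the direct sum lowers them by a further p - 1 and
    the total shift is n + 1.\<close>
  have high: "?v i = w (i + 1) - (int n + 1)" if "int p \<le> i" "i \<le> int n" for i
  proof -
    have "?y (i - int (p - 1)) = w (i + 1) - (int n + 2 - int p)"
      using y[of "i - int (p - 1)"] that pn by (simp add: of_nat_diff)
    then show ?thesis
      using oplus_high[of "p - 1" i x ?y] rng[OF that] that pn by (simp add: of_nat_diff del: o_apply)
  qed
  show ?thesis
  proof (rule phi_rel_extend[OF w pn x, where c = "int n + 1"])
    show "of_word (st (word w 1 p)) i < of_word (st (word w 1 p)) j \<longleftrightarrow> w i < w j"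
      if "1 \<le> i" "i \<le> int p" "1 \<le> j" "j \<le> int p" for i j
    proof -
      have "of_word (st (word w 1 p)) k = w k - int ?m" if "1 \<le> k" "k \<le> int p" for k
        using of_word_st_word[of w 1 p "int ?m" "int (n + 1)" k] img(1) that by simp
      with that show ?thesis by simp
    qed
    show "?v (- i) = - ?v i" for i
      by (rule oplus_minus)
        (simp_all only: o_apply of_word_minus longest_minus signed_perms_minus[OF phi_relD(1)[OF x]])
    show "?v i = i" if "i > int n" for i
    proof -
      have "\<bar>i - int (p - 1)\<bar> > int ?m" using that pn by (simp add: of_nat_diff)
      then have "?y (i - int (p - 1)) = i - int (p - 1)"
        using len by (simp add: of_word_outside longest_outside)
      then show ?thesis
        using that pn oplus_high[of "p - 1" i x ?y] by (simp add: of_nat_diff del: o_apply)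
    qed
    show "?v i = x i" if "0 \<le> i" "i < int p" for i
      using that pn by (simp add: oplus_def of_nat_diff)
    show "?v i = w (i + 1) - (int n + 1) \<and> int p \<le> \<bar>?v i\<bar> \<and> \<bar>?v i\<bar> \<le> int n"
      if "int p \<le> i" "i \<le> int n" for i
      using high[OF that] rng[OF that] pn by auto
    show "?v j < 0 \<longleftrightarrow> w (j + 1) < w (i + 1)"
      if "0 \<le> i" "i < int p" "int p \<le> j" "j \<le> int n" for i j
    proof -
      have "w (j + 1) < w (i + 1)" using p that by (simp add: global_descents_def)
      with high[OF that(3,4)] rng[OF that(3,4)] pn show ?thesis by simp
    qed
    show "?v i < 0 \<longleftrightarrow> ?v j < 0"
      if "int p \<le> i" "i \<le> int n" "int p \<le> j" "j \<le> int n" for i j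
      using high[OF that(1,2)] high[OF that(3,4)] rng[OF that(1,2)] rng[OF that(3,4)] pn by simp
  qed
qed

section \<open>Well-definedness and bijectivity\<close>

lemma phi_graph_phi_rel: "phi_graph n w v \<Longrightarrow> phi_rel n w v"
proof (induction rule: phi_graph.induct)
  case base
  show ?case by (simp add: phi_rel_def last_dominates_def id_signed_perms del: id_apply)
next
  case (asc n w p x)
  then show ?case using phi_rel_asc[of w n p x] by (simp add: separable_S_iff)
next
  case (desc n w p x)
  then show ?case using phi_rel_desc[of w n p x] by (simp add: separable_S_iff)
qed

lemma of_word_perms:
  assumes "set a \<subseteq> {1..int (length a)}" "distinct a" shows "of_word a \<in> perms (length a)"
proof (rule permsI)
  show "of_word a (- i) = - of_word a i" for i by (rule of_word_minus)
  show "of_word a i = i" if "i > int (length a)" for i using that by (simp add: of_word_outside)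
  show "1 \<le> of_word a i \<and> of_word a i \<le> int (length a)" if "1 \<le> i" "i \<le> int (length a)" for i
  proof -
    have "a ! nat (i - 1) \<in> set a" using that by (intro nth_mem) auto
    with assms(1) have "a ! nat (i - 1) \<in> {1..int (length a)}" by blast
    with that show ?thesis by (simp add: of_word_nth)
  qed
  show "of_word a i \<noteq> of_word a j" if "1 \<le> i" "i < j" "j \<le> int (length a)" for i j
    using that assms(2) by (auto simp: of_word_nth nth_eq_iff_index_eq)
qed

text \<open>Covers letters that need not fill an interval, as happens for the word 0 v_1 ... v_n
  from which a preimage is built.\<close>

lemma of_word_st:
  assumes "distinct a"
  shows "of_word (st a) \<in> perms (length a)"
    and "1 \<le> i \<Longrightarrow> i \<le> int (length a) \<Longrightarrow> 1 \<le> j \<Longrightarrow> j \<le> int (length a) \<Longrightarrow>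
      of_word (st a) i < of_word (st a) j \<longleftrightarrow> of_word a i < of_word a j"
proof -
  let ?r = "\<lambda>x. card {y \<in> set a. y \<le> x}"
  have less: "?r x < ?r y \<longleftrightarrow> x < y" if "x \<in> set a" "y \<in> set a" for x y
    using card_le_less_iff[of "set a" x y "\<lambda>z. z"] that by simp
  have "set (st a) \<subseteq> {1..int (length (st a))}"
  proof
    fix z assume "z \<in> set (st a)"
    then obtain x where x: "x \<in> set a" "z = int (?r x)" by (auto simp: st_def)
    then have "?r x > 0" by (auto simp: card_gt_0_iff)
    moreover have "?r x \<le> card (set a)" by (rule card_mono) auto
    ultimately show "z \<in> {1..int (length (st a))}"
      using card_length[of a] x by (simp add: st_def)
  qed
  moreover have "distinct (st a)"
  proof -
    have "inj_on (\<lambda>x. int (?r x)) (set a)"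
    proof (rule inj_onI)
      fix x y assume "x \<in> set a" "y \<in> set a" "int (?r x) = int (?r y)"
      with less[of x y] less[of y x] show "x = y" by linarith
    qed
    then show ?thesis using assms by (simp add: st_def distinct_map)
  qed
  ultimately show "of_word (st a) \<in> perms (length a)"
    using of_word_perms[of "st a"] by (simp add: st_def)
  assume ij: "1 \<le> i" "i \<le> int (length a)" "1 \<le> j" "j \<le> int (length a)"
  then have "a ! nat (i - 1) \<in> set a" "a ! nat (j - 1) \<in> set a" by (auto intro!: nth_mem)
  with less ij show "of_word (st a) i < of_word (st a) j \<longleftrightarrow> of_word a i < of_word a j"
    by (simp add: st_def of_word_map) (simp add: of_word_nth)
qed

text \<open>Avoidance supplies a splitting position p \<le> n and passes to the left block, so the
  recursive call is again on a separable permutation and has the smaller index p - 1.\<close>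

lemma phi_graph_exists: "w \<in> separable_S (n + 1) \<Longrightarrow> \<exists>v. phi_graph n w v"
proof (induction n arbitrary: w rule: less_induct)
  case (less n)
  then have w: "w \<in> perms (n + 1)" and av: "avoids 1 (int (n + 1)) w"
    by (simp_all only: separable_S_iff)
  show ?case
  proof (cases "n = 0")
    case True
    have "w ` {1..int 1} = {1..int 1}" using perms_image[OF w] True by simp
    then have "w 1 = 1" by auto
    then have "w = id"
      using increasing_signed_perm_eq_id[OF perms_signed[OF w]] True
        signed_perms_zero[OF perms_signed[OF w]] by simp
    with True phi_graph.base show ?thesis by blast
  next
    case False
    have inj: "inj_on w {1..int (n + 1)}"
      using signed_perms_eq_iff[OF perms_signed[OF w]] by (simp add: inj_on_def)
    obtain p where "p \<in> global_ascents (n + 1) w \<or> p \<in> global_descents (n + 1) w"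
      using global_ascent_or_descent[OF av inj] False by auto
    then show ?thesis
    proof
      assume p: "p \<in> global_ascents (n + 1) w"
      then have pn: "1 \<le> p" "p \<le> n" by (auto simp: global_ascents_def)
      have "distinct (word w 1 p)"
        using signed_perms_eq_iff[OF perms_signed[OF w]]
        by (simp add: word_def distinct_map inj_on_def)
      then have "of_word (word w 1 p) \<in> perms p"
        using of_word_perms[of "word w 1 p"] global_ascents_image(1)[OF w p]
        by (simp add: set_word length_word)
      moreover have "avoids 1 (int p) (of_word (word w 1 p))"
        by (rule avoids_shift_mono[where d = 0, OF av]) (use pn in \<open>auto simp: of_word_word\<close>)
      ultimately have sep: "of_word (word w 1 p) \<in> separable_S (p - 1 + 1)"
        using pn by (simp add: separable_S_iff)
      have "p - 1 < n" using pn by linarith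
      from less.IH[OF this sep] obtain x where x: "phi_graph (p - 1) (of_word (word w 1 p)) x"
        by blast
      from phi_graph.asc[OF _ less.prems p x] False show ?thesis by auto
    next
      assume p: "p \<in> global_descents (n + 1) w"
      then have pn: "1 \<le> p" "p \<le> n" by (auto simp: global_descents_def)
      have len: "length (word w 1 p) = p" by (simp add: length_word)
      have distinct: "distinct (word w 1 p)"
        using signed_perms_eq_iff[OF perms_signed[OF w]]
        by (simp add: word_def distinct_map inj_on_def)
      have "of_word (st (word w 1 p)) \<in> perms p"
        using of_word_st(1)[OF distinct] by (simp only: len)
      moreover have "avoids 1 (int p) (of_word (st (word w 1 p)))"
        by (rule avoids_shift_mono[where d = 0, OF av])
          (use pn of_word_st(2)[OF distinct] in \<open>auto simp: length_word of_word_word\<close>)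
      ultimately have sep: "of_word (st (word w 1 p)) \<in> separable_S (p - 1 + 1)"
        using pn by (simp add: separable_S_iff)
      have "p - 1 < n" using pn by linarith
      from less.IH[OF this sep] obtain x where x: "phi_graph (p - 1) (of_word (st (word w 1 p))) x"
        by blast
      from phi_graph.desc[OF _ less.prems p x] False show ?thesis by auto
    qed
  qed
qed

text \<open>Any two values of the relation satisfy \<open>phi_rel\<close> for the same w and hence
  agree, so the definite description in \<open>phi\<close> denotes the value obtained.\<close>

lemma phi_rel_phi:
  assumes "w \<in> separable_S (n + 1)" shows "phi_rel n w (phi n w)"
proof -
  obtain v where v: "phi_graph n w v" using phi_graph_exists[OF assms] by blast
  have "phi n w = v"
    unfolding phi_def using v phi_rel_unique phi_graph_phi_rel by (intro the_equality) blast+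
  with v phi_graph_phi_rel show ?thesis by simp
qed

text \<open>The word of v is order isomorphic to w_2 ... w_{n+1}, hence the shift by 1.\<close>

lemma phi_rel_separable_B:
  assumes "w \<in> separable_S (n + 1)" "phi_rel n w v" shows "v \<in> separable_B n"
proof -
  have w: "w \<in> perms (n + 1)" and av: "avoids 1 (int (n + 1)) w"
    using assms(1) by (simp_all only: separable_S_iff)
  note v = phi_relD(1)[OF assms(2)]
  have "avoids 1 (int n) v"
  proof (rule avoids_shift_mono[where d = 1, OF av])
    fix i j assume ij: "1 \<le> i" "i \<le> int n" "1 \<le> j" "j \<le> int n"
    have "v i = v j \<longleftrightarrow> i = j" "w (i + 1) = w (j + 1) \<longleftrightarrow> i = j"
      using signed_perms_eq_iff[OF v] signed_perms_eq_iff[OF perms_signed[OF w]] by auto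
    with phi_relD(3)[OF assms(2), of i j] phi_relD(3)[OF assms(2), of j i] ij
    show "v i < v j \<longleftrightarrow> w (i + 1) < w (j + 1)"
      by (cases i j rule: linorder_cases) auto
  qed auto
  with v phi_relD(2)[OF assms(2)] show ?thesis by (simp add: separable_B_iff)
qed

lemma phi_rel_surj:
  assumes "v \<in> separable_B n" obtains w where "w \<in> separable_S (n + 1)" "phi_rel n w v"
proof
  have v: "v \<in> signed_perms n" and dom: "last_dominates n v" and av: "avoids 1 (int n) v"
    using assms by (simp_all add: separable_B_iff)
  let ?w = "of_word (st (word v 0 n))"
  have len: "length (word v 0 n) = n + 1" by (simp add: length_word)
  have distinct: "distinct (word v 0 n)"
    using signed_perms_eq_iff[OF v] by (simp add: word_def distinct_map inj_on_def)
  have less: "?w (i + 1) < ?w (j + 1) \<longleftrightarrow> v i < v j"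
    if "0 \<le> i" "i \<le> int n" "0 \<le> j" "j \<le> int n" for i j
    using of_word_st(2)[OF distinct, of "i + 1" "j + 1"] that
    by (simp add: len of_word_word)
  have "avoids 0 (int n) v"
    unfolding avoids_def
  proof (intro allI impI, elim conjE)
    fix i j k l assume *: "0 \<le> i" "i < j" "j < k" "k < l" "l \<le> int n"
    show "\<not> (v j < v l \<and> v l < v i \<and> v i < v k) \<and> \<not> (v k < v i \<and> v i < v l \<and> v l < v j)"
    proof (cases "i = 0")
      case True
      \<comment> \<open>A pattern using index 0 has 0 as its first letter. For 3142, v j < v l < 0 <
        v k, so v k + v l < 0 although v j + v k \<ge> 0; for 2413, v k < 0 < v l < v j, so v j + v
        k < 0 although v k + v l \<ge> 0.\<close>
      have "v j + v k < 0 \<longleftrightarrow> v k < 0" "v j + v l < 0 \<longleftrightarrow> v l < 0" "v k + v l < 0 \<longleftrightarrow> v l < 0"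
        using * by (intro last_dominatesD[OF dom]; simp)+
      with True signed_perms_zero[OF v] show ?thesis by auto
    next
      case False
      with avoidsD[OF av, of i j k l] * show ?thesis by auto
    qed
  qed
  then have "avoids 1 (int (n + 1)) ?w"
  proof (rule avoids_shift_mono[where d = "-1"])
    show "?w i < ?w j \<longleftrightarrow> v (i + -1) < v (j + -1)"
      if "1 \<le> i" "i \<le> int (n + 1)" "1 \<le> j" "j \<le> int (n + 1)" for i j
      using less[of "i - 1" "j - 1"] that by simp
  qed auto
  then show "?w \<in> separable_S (n + 1)"
    using of_word_st(1)[OF distinct] by (simp add: separable_S_iff len)
  show "phi_rel n ?w v" using v dom less by (simp add: phi_rel_def)
qed

theorem theorem4p13:
  fixes n :: nat
  shows "bij_betw (phi n) (separable_S (n + 1)) (separable_B n) \<and>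
    (\<forall>u\<in>separable_S (n + 1). \<forall>w\<in>separable_S (n + 1).
       left_weak_le (generators_S (n + 1)) u w \<longleftrightarrow>
       left_weak_le (generators_B n) (phi n u) (phi n w))"
proof -
  \<comment> \<open>Both containments unfold to one condition on the letters of u and w, so order
    preservation and reflection come together; injectivity follows by applying it in both
    directions.\<close>
  have subset_iff: "inversions (n + 1) u \<subseteq> inversions (n + 1) w \<longleftrightarrow>
      inversions n (phi n u) \<subseteq> inversions n (phi n w)"
    if "u \<in> separable_S (n + 1)" "w \<in> separable_S (n + 1)" for u w
    using perms_inversions_subset_iff[of u n w]
      phi_rel_inversions_subset_iff[OF phi_rel_phi[OF that(1)] phi_rel_phi[OF that(2)]] that
    by (simp add: separable_S_iff)
  have "inj_on (phi n) (separable_S (n + 1))"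
  proof (rule inj_onI)
    fix u w assume *: "u \<in> separable_S (n + 1)" "w \<in> separable_S (n + 1)" "phi n u = phi n w"
    then have "inversions (n + 1) u = inversions (n + 1) w"
      using subset_iff[of u w] subset_iff[of w u] by auto
    with * show "u = w"
      by (intro inversions_inject[of u "n + 1" w]) (auto simp: separable_S_iff perms_signed)
  qed
  moreover have "phi n ` separable_S (n + 1) = separable_B n"
  proof (intro equalityI subsetI)
    fix v assume "v \<in> separable_B n"
    then obtain w where w: "w \<in> separable_S (n + 1)" "phi_rel n w v" by (rule phi_rel_surj)
    then have "v = phi n w" using phi_rel_unique phi_rel_phi by blast
    with w(1) show "v \<in> phi n ` separable_S (n + 1)" by blast
  qed (use phi_rel_phi phi_rel_separable_B in blast)
  ultimately have "bij_betw (phi n) (separable_S (n + 1)) (separable_B n)"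
    by (simp add: bij_betw_def)
  moreover have "left_weak_le (generators_S (n + 1)) u w \<longleftrightarrow>
      left_weak_le (generators_B n) (phi n u) (phi n w)"
    if "u \<in> separable_S (n + 1)" "w \<in> separable_S (n + 1)" for u w
  proof -
    have "u \<in> perms (n + 1)" "w \<in> perms (n + 1)" using that by (simp_all add: separable_S_iff)
    moreover have "phi n u \<in> signed_perms n" "phi n w \<in> signed_perms n"
      using phi_relD(1)[OF phi_rel_phi] that by blast+
    ultimately show ?thesis
      using subset_iff[OF that] by (simp only: left_weak_le_S_iff left_weak_le_B_iff)
  qed
  ultimately show ?thesis by blast
qed

end
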